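(* Let $I=[-1,1]$ and $s>1$. If $\psi\in G^s(I)$ is real-valued, then $m_\psi(\lambda)=O(\log\log\lambda)$ as $\lambda\to\infty$. This bound is sharp: there exist a real-valued $\psi\in G^s(I)$ and a sequence $\lambda_n\to\infty$ such that $$|m_\psi(\lambda_n)|\approx\log\log\lambda_n$$ for all sufficiently large $n$.
   Context: For a real-valued $\psi\in C^1(I)$, $I=[-1,1]$, and $\lambda>0$, the Stein--Wainger oscillatory integral is $m_\psi(\lambda):=\mathrm{p.v.}\int_{-1}^{1}e^{i\lambda\psi(t)}\frac{dt}{t}=\lim_{\varepsilon\to0^+}\int_{\varepsilon\le|t|\le1}e^{i\lambda\psi(t)}\frac{dt}{t}$. For $s\ge1$, a function $\psi\in C^\infty(I)$ belongs to the Gevrey class $G^s(I)$ if there is a constant $K>0$ such that $\sup_{t\in I}|\psi^{(n)}(t)|\le K^{n+1}(n!)^s$ for all $n\ge0$. Implicit constants may depend on $\psi$ and $s$ but not on $\lambda$. $X\approx Y$ means $cY\le X\le CY$ for some constants $c,C>0$ independent of $n$ (and of $\lambda_n$). *)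

theory Defs
  imports "HOL-Analysis.Analysis" "HOL-Library.Landau_Symbols"
begin

text \<open>
  Derivatives of a function on \<open>I = [-1,1]\<close> are taken within \<open>I\<close>, hence are one-sided at the
  endpoints, and the values of the function outside \<open>I\<close> are irrelevant.
\<close>

primrec deriv_on :: "real set \<Rightarrow> nat \<Rightarrow> (real \<Rightarrow> real) \<Rightarrow> real \<Rightarrow> real" where
  "deriv_on S 0 f = f"
| "deriv_on S (Suc n) f = (\<lambda>t. vector_derivative (deriv_on S n f) (at t within S))"

definition C_infinity_on :: "real set \<Rightarrow> (real \<Rightarrow> real) \<Rightarrow> bool" where
  "C_infinity_on S f \<longleftrightarrow> (\<forall>n. deriv_on S n f differentiable_on S)"

definition gevrey :: "real \<Rightarrow> real set \<Rightarrow> (real \<Rightarrow> real) set" where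
  "gevrey s S = {\<psi>. C_infinity_on S \<psi> \<and>
     (\<exists>K>0. \<forall>n. \<forall>t\<in>S. \<bar>deriv_on S n \<psi> t\<bar> \<le> K ^ (n + 1) * fact n powr s)}"

definition truncated_stein_wainger :: "(real \<Rightarrow> real) \<Rightarrow> real \<Rightarrow> real \<Rightarrow> complex" where
  "truncated_stein_wainger \<psi> lam \<epsilon> =
     integral {t. \<epsilon> \<le> \<bar>t\<bar> \<and> \<bar>t\<bar> \<le> 1}
       (\<lambda>t. exp (\<i> * complex_of_real (lam * \<psi> t)) / complex_of_real t)"

definition stein_wainger :: "(real \<Rightarrow> real) \<Rightarrow> real \<Rightarrow> complex" where
  "stein_wainger \<psi> lam = Lim (at_right 0) (truncated_stein_wainger \<psi> lam)"

text \<open>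
  The principal value exists for every \<open>C\<^sup>1\<close> phase, so the \<open>Lim\<close> above is a genuine limit.
\<close>

lemma truncated_stein_wainger_tendsto:
  fixes \<psi> \<psi>' :: "real \<Rightarrow> real" and lam :: real
  assumes deriv: "\<And>t. t \<in> {-1..1} \<Longrightarrow> (\<psi> has_vector_derivative \<psi>' t) (at t within {-1..1})"
    and cont: "continuous_on {-1..1} \<psi>'"
  shows "(truncated_stein_wainger \<psi> lam \<longlongrightarrow> stein_wainger \<psi> lam) (at_right 0)"
proof -
  define E where "E t = exp (\<i> * complex_of_real (lam * \<psi> t))" for t
  define f where "f t = E t / complex_of_real t" for t
  define h where "h t = f t + f (-t)" for t
  let ?F = "truncated_stein_wainger \<psi> lam"
  have "bounded (\<psi>' ` {-1..1})"
    by (intro compact_imp_bounded compact_continuous_image cont) auto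
  then obtain B where "B > 0" and B: "\<And>t. t \<in> {-1..1} \<Longrightarrow> \<bar>\<psi>' t\<bar> \<le> B"
    by (auto simp: bounded_pos)
  have derivE: "(E has_vector_derivative (\<i> * complex_of_real (lam * \<psi>' t)) * E t) (at t within {-1..1})"
    if "t \<in> {-1..1}" for t
  proof -
    have "((\<lambda>t. \<i> * complex_of_real (lam * \<psi> t)) has_vector_derivative \<i> * complex_of_real (lam * \<psi>' t))
            (at t within {-1..1})"
      by (intro has_vector_derivative_mult_right has_vector_derivative_of_real
            DERIV_cmult deriv[folded has_real_derivative_iff_has_vector_derivative] that)
    from field_vector_diff_chain_within[OF this, of exp "E t"]
    show ?thesis
      by (simp add: E_def[abs_def] o_def DERIV_exp has_field_derivative_at_within)
  qed
  have contE: "continuous_on {-1..1} E"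
    using derivE by (meson has_vector_derivative_continuous continuous_on_eq_continuous_within)
  have lipE: "norm (E x - E y) \<le> (\<bar>lam\<bar> * B) * norm (x - y)" if "x \<in> {-1..1}" "y \<in> {-1..1}" for x y
  proof (rule differentiable_bound[OF _ _ _ that])
    fix t :: real assume t: "t \<in> {-1..1}"
    show "(E has_derivative (\<lambda>u. u *\<^sub>R ((\<i> * complex_of_real (lam * \<psi>' t)) * E t))) (at t within {-1..1})"
      using derivE[OF t] by (simp add: has_vector_derivative_def)
    have "norm ((\<i> * complex_of_real (lam * \<psi>' t)) * E t) \<le> \<bar>lam\<bar> * B"
      using B[OF t] by (simp add: norm_mult E_def abs_mult mult_left_mono)
    then show "onorm (\<lambda>u. u *\<^sub>R ((\<i> * complex_of_real (lam * \<psi>' t)) * E t)) \<le> \<bar>lam\<bar> * B"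
      by (intro onorm_le) (simp add: mult.commute mult_left_mono)
  qed auto
  have h_bound: "norm (h t) \<le> 2 * \<bar>lam\<bar> * B" if "t \<in> {0<..1}" for t
  proof -
    have "h t = (E t - E (-t)) / complex_of_real t"
      using that by (simp add: h_def f_def diff_divide_distrib)
    moreover have "norm (E t - E (-t)) \<le> (\<bar>lam\<bar> * B) * (2 * t)"
      using lipE[of t "-t"] that by simp
    ultimately show ?thesis
      using that by (simp add: norm_divide divide_le_eq algebra_simps)
  qed
  have contf: "continuous_on {\<epsilon>..1} f" "continuous_on {\<epsilon>..1} (\<lambda>t. f (-t))"
    if "\<epsilon> > 0" for \<epsilon>
    unfolding f_def using that
    by (auto intro!: continuous_intros continuous_on_subset[OF contE]
          continuous_on_compose2[OF contE])
  have conth: "continuous_on {\<epsilon>..1} h" if "\<epsilon> > 0" for \<epsilon>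
    unfolding h_def by (intro continuous_on_add contf that)
  have F_eq: "?F \<epsilon> = integral {\<epsilon>..1} h" if "\<epsilon> \<in> {0<..1}" for \<epsilon>
  proof -
    have 1: "(f has_integral integral {\<epsilon>..1} f) {\<epsilon>..1}"
      "((\<lambda>t. f (-t)) has_integral integral {\<epsilon>..1} (\<lambda>t. f (-t))) {\<epsilon>..1}"
      using that contf by (auto intro!: integrable_integral integrable_continuous_real)
    have 2: "(f has_integral integral {\<epsilon>..1} (\<lambda>t. f (-t))) {-1..-\<epsilon>}"
      using 1(2) has_integral_reflect_real[of f _ "-\<epsilon>" "-1"] by simp
    have "{\<epsilon>..1} \<inter> {-1..-\<epsilon>} = {}"
      using that by auto
    then have "(f has_integral (integral {\<epsilon>..1} f + integral {\<epsilon>..1} (\<lambda>t. f (-t)))) ({\<epsilon>..1} \<union> {-1..-\<epsilon>})"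
      by (intro has_integral_Un 1 2) simp
    moreover have "(h has_integral (integral {\<epsilon>..1} f + integral {\<epsilon>..1} (\<lambda>t. f (-t)))) {\<epsilon>..1}"
      unfolding h_def by (intro has_integral_add 1)
    moreover have "{\<epsilon>..1} \<union> {-1..-\<epsilon>} = {t. \<epsilon> \<le> \<bar>t\<bar> \<and> \<bar>t\<bar> \<le> 1}"
      using that by auto
    ultimately show ?thesis
      by (simp add: truncated_stein_wainger_def f_def[abs_def] E_def integral_unique)
  qed
  have F_diff: "norm (?F x - ?F y) \<le> 2 * \<bar>lam\<bar> * B * (y - x)"
    if "x \<in> {0<..1}" "y \<in> {0<..1}" "x \<le> y" for x y
  proof -
    have "integral {x..y} h + integral {y..1} h = integral {x..1} h"
      using that conth by (intro Henstock_Kurzweil_Integration.integral_combine) (auto intro!: integrable_continuous_real)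
    then have "?F x - ?F y = integral {x..y} h"
      using that by (simp add: F_eq algebra_simps)
    also have "norm \<dots> \<le> 2 * \<bar>lam\<bar> * B * (y - x)"
      using that h_bound conth[of x]
      by (intro integral_bound) (auto intro: continuous_on_subset)
    finally show ?thesis .
  qed
  have "(2 * \<bar>lam\<bar> * B)-lipschitz_on {0<..1} ?F"
  proof (rule lipschitz_onI)
    fix x y :: real assume xy: "x \<in> {0<..1}" "y \<in> {0<..1}"
    show "dist (?F x) (?F y) \<le> 2 * \<bar>lam\<bar> * B * dist x y"
      using F_diff[OF xy] F_diff[OF xy(2,1)]
      by (cases "x \<le> y") (auto simp: dist_norm norm_minus_commute)
  qed (use \<open>B > 0\<close> in auto)
  then have "uniformly_continuous_on {0<..1} ?F"
    by (rule lipschitz_on_uniformly_continuous)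
  moreover have "(0::real) \<in> closure {0<..1}"
    by simp
  ultimately obtain l where "(?F \<longlongrightarrow> l) (at 0 within {0<..1})"
    by (rule uniformly_continuous_on_extension_at_closure)
  moreover have "at 0 within {0<..1} = at_right (0::real)"
    by (rule at_within_nhd[of _ "{-1<..<1}"]) auto
  ultimately have "(?F \<longlongrightarrow> l) (at_right 0)"
    by simp
  then show ?thesis
    unfolding stein_wainger_def using tendsto_Lim[OF trivial_limit_at_right_real] by metis
qed

end

theory Submission
  imports Defs "HOL-Complex_Analysis.Cauchy_Integral_Formula" "HOL-Real_Asymp.Real_Asymp"
begin

text \<open>
The integral over \<open>\<epsilon> \<le> \<bar>t\<bar> \<le> 1\<close> folds onto \<open>{\<epsilon>..1}\<close> with the kernel
\<open>(cis (lam * \<psi> t) - cis (lam * \<psi> (-t))) / t\<close>, which is bounded both by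
\<open>lam * \<bar>\<psi> t - \<psi> (-t)\<bar> / t\<close> and by \<open>2 / t\<close>. The size of the integral is decided by the order of
vanishing of \<open>\<psi> t - \<psi> 0\<close> at the origin.

If some derivative of \<open>\<psi>\<close> of positive order does not vanish at 0, let \<open>m\<close> be the least such order.
Cancellation handles \<open>t \<le> lam ^ (-1 / m)\<close>, integration by parts handles the rest of a fixed
neighbourhood of 0, and the integral is bounded (\<open>stein_wainger_finite_type_bound\<close>).

If all derivatives of positive order vanish at 0, the Gevrey bounds make \<open>\<psi> t - \<psi> 0\<close>
so small that the cancellation is effective for all \<open>t \<le> r\<close>, where \<open>1 / r\<close> is at most a constant
times a power of \<open>ln lam\<close>. The range \<open>t \<ge> r\<close>, estimated trivially, costs \<open>2 * ln (1 / r) = O(ln (ln lam))\<close>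
(\<open>stein_wainger_flat_bound\<close>).

For the sharpness, take \<open>\<psi> t = exp (- 1 / t ^ p)\<close> for \<open>t > 0\<close> and \<open>\<psi> t = 0\<close> otherwise. Cauchy's
inequality on circles of radius proportional to \<open>t\<close> shows that it is Gevrey of order \<open>1 + 1 / p\<close>
(\<open>flat_phase_gevrey\<close>), which is at most \<open>s\<close> for large \<open>p\<close>. Minus the real part of the integral
is the integral of \<open>(1 - cos (lam * \<psi> t)) / t\<close> over \<open>(0, 1]\<close>. The cosine oscillates for
\<open>t \<ge> (ln lam) powr (- 1 / p)\<close> and contributes \<open>O(1)\<close> there, while the term \<open>1 / t\<close> contributes
\<open>ln (ln lam) / p\<close> (\<open>stein_wainger_flat_phase_lower_bound\<close>). This holds for all large
\<open>lam\<close>, so the sequence \<open>lam = n\<close> can be used.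
\<close>

section \<open>The folded integral\<close>

text \<open>
Folding the integral over \<open>\<epsilon> \<le> \<bar>t\<bar> \<le> 1\<close> onto \<open>t > 0\<close> leaves this kernel, in which the
cancellation of the principal value is visible: only \<open>\<psi> t - \<psi> (-t)\<close> matters when it is
small compared with \<open>1 / lam\<close>.
\<close>

definition odd_kernel :: "(real \<Rightarrow> real) \<Rightarrow> real \<Rightarrow> real \<Rightarrow> complex" where
  "odd_kernel \<psi> lam t = (cis (lam * \<psi> t) - cis (lam * \<psi> (-t))) / complex_of_real t"

lemma continuous_on_cis_div:
  assumes "continuous_on {a..b} \<psi>" "0 < a"
  shows "continuous_on {a..b} (\<lambda>t. cis (lam * \<psi> t) / complex_of_real t)"
  using assms(2) by (auto intro!: continuous_intros assms(1))

lemma continuous_on_reflect: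
  fixes \<psi> :: "real \<Rightarrow> 'a::topological_space"
  assumes "continuous_on {-1..1} \<psi>" "0 < a" "b \<le> 1"
  shows "continuous_on {a..b} \<psi>" "continuous_on {a..b} (\<lambda>t. \<psi> (-t))"
  using assms
  by (auto intro!: continuous_intros continuous_on_subset[OF assms(1)] continuous_on_compose2[OF assms(1)])

lemma continuous_on_odd_kernel:
  assumes "continuous_on {-1..1} \<psi>" "0 < a" "b \<le> 1"
  shows "continuous_on {a..b} (odd_kernel \<psi> lam)"
  unfolding odd_kernel_def[abs_def] diff_divide_distrib
  by (intro continuous_on_diff continuous_on_cis_div continuous_on_reflect(1)[OF assms]
      continuous_on_reflect(2)[OF assms] assms(2))

lemma truncated_stein_wainger_eq:
  assumes cont: "continuous_on {-1..1} \<psi>" and "0 < \<epsilon>" "\<epsilon> \<le> 1"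
  shows "truncated_stein_wainger \<psi> lam \<epsilon> = integral {\<epsilon>..1} (odd_kernel \<psi> lam)"
proof -
  define f where "f t = cis (lam * \<psi> t) / complex_of_real t" for t
  define g where "g t = cis (lam * \<psi> (-t)) / complex_of_real t" for t
  have int: "(f has_integral integral {\<epsilon>..1} f) {\<epsilon>..1}" "(g has_integral integral {\<epsilon>..1} g) {\<epsilon>..1}"
    unfolding f_def g_def using assms
    by (auto intro!: integrable_integral integrable_continuous_real continuous_on_cis_div
        continuous_on_reflect)
  have "((\<lambda>t. - g t) has_integral - integral {\<epsilon>..1} g) {\<epsilon>..1}"
    by (rule has_integral_neg[OF int(2)])
  also have "(\<lambda>t. - g t) = (\<lambda>t. f (-t))"
    by (auto simp: f_def g_def)
  finally have "(f has_integral - integral {\<epsilon>..1} g) {-1..-\<epsilon>}"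
    using has_integral_reflect_real[of f _ "-\<epsilon>" "-1"] by simp
  moreover have "negligible ({\<epsilon>..1} \<inter> {-1..-\<epsilon>})"
    using assms by (simp add: Int_atLeastAtMost)
  ultimately have "(f has_integral (integral {\<epsilon>..1} f + - integral {\<epsilon>..1} g)) ({\<epsilon>..1} \<union> {-1..-\<epsilon>})"
    by (intro has_integral_Un int)
  moreover have "(odd_kernel \<psi> lam has_integral (integral {\<epsilon>..1} f - integral {\<epsilon>..1} g)) {\<epsilon>..1}"
    using has_integral_diff[OF int]
    by (simp add: odd_kernel_def[abs_def] f_def g_def diff_divide_distrib)
  moreover have "{\<epsilon>..1} \<union> {-1..-\<epsilon>} = {t. \<epsilon> \<le> \<bar>t\<bar> \<and> \<bar>t\<bar> \<le> 1}"
    using assms by auto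
  ultimately show ?thesis
    by (simp add: truncated_stein_wainger_def f_def[abs_def] cis_conv_exp integral_unique)
qed

lemma norm_cis_diff_le: "norm (cis x - cis y) \<le> \<bar>x - y\<bar>"
proof -
  have "norm (cis x - cis y) \<le> 1 * norm (x - y)"
  proof (rule differentiable_bound[of UNIV])
    fix t :: real
    show "(cis has_derivative (\<lambda>u. u *\<^sub>R (\<i> * cis t))) (at t within UNIV)"
      by (auto intro!: derivative_eq_intros)
    show "onorm (\<lambda>u. u *\<^sub>R (\<i> * cis t)) \<le> 1"
      by (intro onorm_le) (simp add: norm_mult)
  qed auto
  then show ?thesis by simp
qed

text \<open>
The first bound exploits the cancellation and is used close to the origin; the second one
ignores it and costs a logarithm of the ratio of the endpoints.
\<close>

lemma norm_odd_kernel_le: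
  assumes "0 < t" "0 \<le> lam"
  shows "norm (odd_kernel \<psi> lam t) \<le> lam * \<bar>\<psi> t - \<psi> (-t)\<bar> / t"
    and "norm (odd_kernel \<psi> lam t) \<le> 2 / t"
proof -
  have "norm (cis (lam * \<psi> t) - cis (lam * \<psi> (-t))) \<le> \<bar>lam * (\<psi> t - \<psi> (-t))\<bar>"
    using norm_cis_diff_le[of "lam * \<psi> t" "lam * \<psi> (-t)"] by (simp add: right_diff_distrib)
  also have "\<dots> = lam * \<bar>\<psi> t - \<psi> (-t)\<bar>"
    using assms by (simp add: abs_mult)
  finally show "norm (odd_kernel \<psi> lam t) \<le> lam * \<bar>\<psi> t - \<psi> (-t)\<bar> / t"
    using assms by (simp add: odd_kernel_def norm_divide divide_right_mono)
  show "norm (odd_kernel \<psi> lam t) \<le> 2 / t"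
    using norm_triangle_ineq4[of "cis (lam * \<psi> t)" "cis (lam * \<psi> (-t))"] assms
    by (simp add: odd_kernel_def norm_divide divide_right_mono)
qed

lemma has_integral_inverse_real:
  fixes a b :: real
  assumes "0 < a" "a \<le> b"
  shows "((\<lambda>t. 1 / t) has_integral ln (b / a)) {a..b}"
proof -
  have "((\<lambda>t. 1 / t) has_integral (ln b - ln a)) {a..b}"
    using assms
    by (intro fundamental_theorem_of_calculus)
       (auto intro!: derivative_eq_intros simp flip: has_real_derivative_iff_has_vector_derivative
          simp: field_simps)
  then show ?thesis using assms by (simp add: ln_div)
qed

lemma norm_integral_odd_kernel_far:
  assumes "continuous_on {-1..1} \<psi>" "0 \<le> lam" "0 < a" "a \<le> b" "b \<le> 1"
  shows "norm (integral {a..b} (odd_kernel \<psi> lam)) \<le> 2 * ln (b / a)"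
proof -
  have I: "((\<lambda>t. 2 * (1 / t)) has_integral 2 * ln (b / a)) {a..b}"
    using assms by (intro has_integral_mult_right has_integral_inverse_real)
  have "norm (integral {a..b} (odd_kernel \<psi> lam)) \<le> integral {a..b} (\<lambda>t. 2 * (1 / t))"
  proof (rule integral_norm_bound_integral)
    show "odd_kernel \<psi> lam integrable_on {a..b}"
      using assms by (intro integrable_continuous_real continuous_on_odd_kernel)
    show "norm (odd_kernel \<psi> lam t) \<le> 2 * (1 / t)" if "t \<in> {a..b}" for t
      using that assms norm_odd_kernel_le(2)[of t lam \<psi>] by simp
  qed (rule has_integral_integrable[OF I])
  then show ?thesis using integral_unique[OF I] by simp
qed

text \<open>
Since \<open>n > 0\<close>, the factor \<open>1 / t\<close> is absorbed by \<open>t ^ n\<close>, which makes the bound uniform in \<open>\<epsilon>\<close>.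
\<close>

lemma norm_integral_odd_kernel_near:
  assumes "continuous_on {-1..1} \<psi>" "0 \<le> lam" "0 < \<epsilon>" "\<epsilon> \<le> r" "r \<le> 1"
    and n: "0 < n" and A: "0 \<le> A"
    and flat: "\<And>t. 0 < t \<Longrightarrow> t \<le> r \<Longrightarrow> \<bar>\<psi> t - \<psi> (-t)\<bar> \<le> A * t ^ n"
  shows "norm (integral {\<epsilon>..r} (odd_kernel \<psi> lam)) \<le> lam * A * r ^ n"
proof -
  obtain k where k: "n = Suc k" using n by (cases n) auto
  have "norm (odd_kernel \<psi> lam t) \<le> lam * A * r ^ k" if "t \<in> {\<epsilon>..r}" for t
  proof -
    have t: "0 < t" "t \<le> r" using that assms by auto
    have "norm (odd_kernel \<psi> lam t) \<le> lam * \<bar>\<psi> t - \<psi> (-t)\<bar> / t"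
      using t assms by (intro norm_odd_kernel_le) auto
    also have "\<dots> \<le> lam * (A * t ^ n) / t"
      using t assms flat[OF t] by (intro divide_right_mono mult_left_mono) auto
    also have "\<dots> = lam * A * t ^ k"
      using t by (simp add: k)
    also have "\<dots> \<le> lam * A * r ^ k"
      using t assms by (intro mult_left_mono power_mono) auto
    finally show ?thesis .
  qed
  then have "norm (integral {\<epsilon>..r} (odd_kernel \<psi> lam)) \<le> lam * A * r ^ k * (r - \<epsilon>)"
    using assms by (intro integral_bound continuous_on_odd_kernel) auto
  also have "\<dots> \<le> lam * A * r ^ k * r"
    using assms by (intro mult_left_mono) auto
  finally show ?thesis by (simp add: k mult_ac)
qed

lemma norm_stein_wainger_le:
  assumes "\<And>t. t \<in> {-1..1} \<Longrightarrow> (\<psi> has_vector_derivative \<psi>' t) (at t within {-1..1})"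
    and "continuous_on {-1..1} \<psi>'" and "0 < r"
    and bound: "\<And>\<epsilon>. 0 < \<epsilon> \<Longrightarrow> \<epsilon> < r \<Longrightarrow> norm (truncated_stein_wainger \<psi> lam \<epsilon>) \<le> B"
  shows "norm (stein_wainger \<psi> lam) \<le> B"
proof (rule Lim_norm_ubound)
  show "(truncated_stein_wainger \<psi> lam \<longlongrightarrow> stein_wainger \<psi> lam) (at_right 0)"
    by (rule truncated_stein_wainger_tendsto[OF assms(1,2)])
  show "\<forall>\<^sub>F \<epsilon> in at_right 0. norm (truncated_stein_wainger \<psi> lam \<epsilon>) \<le> B"
    using \<open>0 < r\<close> bound by (auto simp: eventually_at_right_field)
qed simp

section \<open>Taylor estimates from the mean value inequality\<close>

text \<open>
A Taylor estimate by \<open>n - j\<close> applications of the mean value inequality. The factor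
\<open>1 / (n - j)!\<close> of the sharp remainder is lost, which is harmless below: in the flat case it
only affects the power of \<open>ln lam\<close> at which the integral is split, hence only the constant
in front of \<open>ln (ln lam)\<close>.
The derivatives are given as a sequence of functions, so that the lemma also applies after
subtracting constants or monomials or shifting the index.
\<close>

lemma iterated_mean_value_bound:
  fixes f :: "nat \<Rightarrow> real \<Rightarrow> real"
  assumes deriv: "\<And>j t. j < n \<Longrightarrow> t \<in> {-1..1} \<Longrightarrow>
      (f j has_real_derivative f (Suc j) t) (at t within {-1..1})"
    and zero: "\<And>j. j < n \<Longrightarrow> f j 0 = 0"
    and bound: "\<And>t. t \<in> {-1..1} \<Longrightarrow> \<bar>f n t\<bar> \<le> M"
    and "j \<le> n" "t \<in> {-1..1}"
  shows "\<bar>f j t\<bar> \<le> M * \<bar>t\<bar> ^ (n - j)"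
  using assms(4,5)
proof (induction arbitrary: t rule: inc_induct)
  case base
  then show ?case using bound by simp
next
  case (step j)
  have M: "0 \<le> M" using bound[of 0] by auto
  have sub: "closed_segment 0 t \<subseteq> {-1..1}"
    using step.prems by (auto simp: closed_segment_eq_real_ivl split: if_splits)
  have "norm (f j t - f j 0) \<le> (M * \<bar>t\<bar> ^ (n - Suc j)) * norm (t - 0)"
  proof (rule field_differentiable_bound)
    fix u assume u: "u \<in> closed_segment 0 t"
    show "(f j has_field_derivative f (Suc j) u) (at u within closed_segment 0 t)"
      using deriv[of j u] step u sub by (meson DERIV_subset subsetD)
    have "\<bar>f (Suc j) u\<bar> \<le> M * \<bar>u\<bar> ^ (n - Suc j)"
      using step u sub by auto
    also have "\<dots> \<le> M * \<bar>t\<bar> ^ (n - Suc j)"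
      using u M by (intro mult_left_mono power_mono)
        (auto simp: closed_segment_eq_real_ivl split: if_splits)
    finally show "norm (f (Suc j) u) \<le> M * \<bar>t\<bar> ^ (n - Suc j)" by simp
  qed auto
  moreover have "n - j = Suc (n - Suc j)" using step by simp
  ultimately show ?case using zero[of j] step by (simp add: mult_ac)
qed

text \<open>
If the derivatives of orders \<open>1, ..., n - 1\<close> vanish at the origin, then \<open>f 0\<close> is constant up to
\<open>O(t ^ n)\<close>, and the constant drops out of the difference.
\<close>

lemma abs_diff_le_of_flat:
  fixes f :: "nat \<Rightarrow> real \<Rightarrow> real"
  assumes deriv: "\<And>j t. j < n \<Longrightarrow> t \<in> {-1..1} \<Longrightarrow>
      (f j has_real_derivative f (Suc j) t) (at t within {-1..1})"
    and zero: "\<And>j. 0 < j \<Longrightarrow> j < n \<Longrightarrow> f j 0 = 0"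
    and bound: "\<And>t. t \<in> {-1..1} \<Longrightarrow> \<bar>f n t\<bar> \<le> M"
    and "0 < n" "0 < t" "t \<le> 1"
  shows "\<bar>f 0 t - f 0 (-t)\<bar> \<le> 2 * M * t ^ n"
proof -
  \<comment> \<open>\<open>f 0 0\<close> itself need not vanish; subtracting it changes no derivative.\<close>
  define g where "g j = (if j = 0 then (\<lambda>t. f 0 t - f 0 0) else f j)" for j
  have "\<bar>g 0 u\<bar> \<le> M * \<bar>u\<bar> ^ (n - 0)" if "u \<in> {-1..1}" for u
  proof (rule iterated_mean_value_bound)
    fix j t assume "j < n" "t \<in> {-1..1::real}"
    then show "(g j has_real_derivative g (Suc j) t) (at t within {-1..1})"
      using deriv[of j t] by (auto simp: g_def intro!: derivative_eq_intros)
  qed (use zero bound that \<open>0 < n\<close> in \<open>auto simp: g_def\<close>)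
  from this[of t] this[of "-t"] show ?thesis
    using assms(5,6) by (simp add: g_def)
qed

lemma truncated_stein_wainger_split:
  assumes "continuous_on {-1..1} \<psi>" "0 < \<epsilon>" "\<epsilon> \<le> r" "r \<le> 1"
  shows "truncated_stein_wainger \<psi> lam \<epsilon> =
    integral {\<epsilon>..r} (odd_kernel \<psi> lam) + integral {r..1} (odd_kernel \<psi> lam)"
  using assms
  by (simp add: truncated_stein_wainger_eq Henstock_Kurzweil_Integration.integral_combine
      integrable_continuous_real continuous_on_odd_kernel)

lemma C1_of_derivative_sequence:
  fixes f :: "nat \<Rightarrow> real \<Rightarrow> real"
  assumes "\<And>j t. t \<in> {-1..1} \<Longrightarrow> (f j has_real_derivative f (Suc j) t) (at t within {-1..1})"
  shows "\<And>t. t \<in> {-1..1} \<Longrightarrow> (f 0 has_vector_derivative f 1 t) (at t within {-1..1})"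
    and "continuous_on {-1..1} (f j)"
  using assms[of _ 0] DERIV_continuous_on[OF assms, of j]
  by (simp_all add: has_real_derivative_iff_has_vector_derivative)

section \<open>Phases that are flat at the origin\<close>

text \<open>
The flat case, where the double logarithm comes from. For every order \<open>n\<close> the Gevrey bound gives
\<open>\<bar>f 0 t - f 0 (-t)\<bar> \<le> 2 K ^ (n + 1) (n!) ^ s t ^ n\<close>. With \<open>n\<close> close to \<open>ln lam\<close> and
\<open>r = 1 / (K e n ^ s)\<close> the quantity \<open>lam (K r) ^ n (n!) ^ s\<close> is at most \<open>lam e ^ (-n) \<le> 1\<close>, so the
range \<open>t \<le> r\<close> contributes \<open>O(1)\<close>. The remaining range contributes at most \<open>2 ln (1 / r)\<close>, and
\<open>ln (1 / r) = s ln n + O(1) = s ln (ln lam) + O(1)\<close>.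
\<close>

lemma stein_wainger_flat_bound:
  fixes f :: "nat \<Rightarrow> real \<Rightarrow> real"
  assumes deriv: "\<And>j t. t \<in> {-1..1} \<Longrightarrow> (f j has_real_derivative f (Suc j) t) (at t within {-1..1})"
    and bound: "\<And>n t. t \<in> {-1..1} \<Longrightarrow> \<bar>f n t\<bar> \<le> K ^ (n + 1) * fact n powr s"
    and K: "1 \<le> K" and s: "0 \<le> s"
    and flat: "\<And>j. 0 < j \<Longrightarrow> f j 0 = 0"
  shows "\<exists>C. \<forall>\<^sub>F lam in at_top. norm (stein_wainger (f 0) lam) \<le> C * ln (ln lam)"
proof -
  note C1 = C1_of_derivative_sequence[of f, OF deriv]
  have "norm (stein_wainger (f 0) lam) \<le> (2 * K + 2 * ln K + 2 + 4 * s) * ln (ln lam)"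
    if lam: "lam \<ge> exp (exp 1)" for lam
  proof (rule norm_stein_wainger_le[OF C1(1) C1(2)])
    define n where "n = nat \<lceil>ln lam\<rceil>"
    define r where "r = 1 / (K * exp 1 * real n powr s)"
    have lam0: "0 < lam" using lam exp_gt_zero less_le_trans by blast
    have e: "exp 1 \<le> ln lam" using lam lam0 by (simp add: ln_ge_iff)
    then have ln1: "1 \<le> ln lam" using exp_ge_add_one_self[of 1] by linarith
    have L: "1 \<le> ln (ln lam)" using e ln1 by (subst ln_ge_iff) auto
    have n: "ln lam \<le> real n" "real n \<le> 2 * ln lam" "0 < n"
      using ln1 unfolding n_def by linarith+
    have np: "1 \<le> real n powr s" using n s ln1 by (intro ge_one_powr_ge_zero) auto
    have den: "1 \<le> K * exp 1 * real n powr s"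
      using K np by (intro mult_ge1_I) auto
    then have r: "0 < r" and r1: "r \<le> 1" by (auto simp: r_def)
    show "0 < r" by (rule r)
    \<comment> \<open>The choices of \<open>n\<close> and \<open>r\<close> make the factor \<open>e ^ (-n)\<close> hidden in \<open>r ^ n\<close> cancel \<open>lam\<close>.\<close>
    have "lam \<le> exp (real n)" using n(1) lam0 by (metis exp_le_cancel_iff exp_ln)
    have "(fact n :: real) \<le> real (n ^ n)"
      by (rule fact_le_power)
    then have "fact n powr s \<le> real (n ^ n) powr s"
      using s by (intro powr_mono2) auto
    also have "\<dots> = (real n powr s) ^ n"
      using n(3) by (simp add: powr_realpow[symmetric] powr_powr powr_power mult.commute)
    finally have fact_le: "fact n powr s \<le> (real n powr s) ^ n" .
    fix \<epsilon> :: real assume eps: "0 < \<epsilon>" "\<epsilon> < r"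
    define A where "A = 2 * (K ^ (n + 1) * fact n powr s)"
    have "norm (integral {\<epsilon>..r} (odd_kernel (f 0) lam)) \<le> lam * A * r ^ n"
    proof (rule norm_integral_odd_kernel_near)
      fix t :: real assume t: "0 < t" "t \<le> r"
      show "\<bar>f 0 t - f 0 (-t)\<bar> \<le> A * t ^ n" unfolding A_def
        using t r1 n(3) by (intro abs_diff_le_of_flat deriv flat bound) auto
    qed (use eps r1 n(3) K lam0 C1(2) in \<open>auto simp: A_def\<close>)
    also have "\<dots> \<le> exp (real n) * (2 * (K ^ (n + 1) * (real n powr s) ^ n)) * r ^ n"
      unfolding A_def using \<open>lam \<le> exp (real n)\<close> fact_le K r lam0
      by (intro mult_right_mono mult_mono) auto
    also have "\<dots> = 2 * K"
      using K np by (simp add: r_def power_divide power_mult_distrib exp_of_nat_mult[symmetric])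
    finally have near: "norm (integral {\<epsilon>..r} (odd_kernel (f 0) lam)) \<le> 2 * K" .
    have "norm (integral {r..1} (odd_kernel (f 0) lam)) \<le> 2 * ln (1 / r)"
      using r r1 lam0 C1(2) by (intro norm_integral_odd_kernel_far) auto
    also have "ln (1 / r) = ln K + 1 + s * ln (real n)"
      using K n(3) by (simp add: r_def ln_mult)
    finally have far0: "norm (integral {r..1} (odd_kernel (f 0) lam)) \<le> 2 * (ln K + 1 + s * ln (real n))" .
    have "ln (real n) \<le> ln (2 * ln lam)"
      using n by simp
    also have "\<dots> = ln 2 + ln (ln lam)"
      using ln1 by (simp add: ln_mult)
    also have "\<dots> \<le> ln (ln lam) + ln (ln lam)"
      using ln_2_less_1 L by simp
    finally have "s * ln (real n) \<le> s * (ln (ln lam) + ln (ln lam))"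
      using s by (rule mult_left_mono)
    with far0 have far: "norm (integral {r..1} (odd_kernel (f 0) lam)) \<le>
        2 * (ln K + 1 + s * (ln (ln lam) + ln (ln lam)))"
      by simp
    have "norm (truncated_stein_wainger (f 0) lam \<epsilon>) \<le>
        2 * K + 2 * (ln K + 1 + s * (ln (ln lam) + ln (ln lam)))"
      using near far eps r1 C1(2)
      by (subst truncated_stein_wainger_split[of _ _ r]) (auto intro: norm_triangle_mono)
    also have "\<dots> = (2 * K + 2 * ln K + 2) * 1 + 4 * s * ln (ln lam)"
      by (simp add: algebra_simps)
    also have "\<dots> \<le> (2 * K + 2 * ln K + 2) * ln (ln lam) + 4 * s * ln (ln lam)"
      using L K by (intro add_right_mono mult_left_mono) auto
    finally show "norm (truncated_stein_wainger (f 0) lam \<epsilon>) \<le>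
        (2 * K + 2 * ln K + 2 + 4 * s) * ln (ln lam)"
      by (simp add: algebra_simps)
  qed
  then show ?thesis
    by (auto simp: eventually_at_top_linorder)
qed

section \<open>Phases of finite type at the origin\<close>

text \<open>
Integration by parts against \<open>w = 1 / (lam \<phi>' t)\<close>. Here \<open>w\<close> is of size
\<open>1 / (lam t ^ (k + 1))\<close> and \<open>w'\<close> of size \<open>1 / (lam t ^ (k + 2))\<close>, so the boundary terms and the
remaining integral are dominated by the left endpoint.
\<close>

lemma nonstationary_integral_bound:
  fixes \<phi> \<phi>' \<phi>'' :: "real \<Rightarrow> real"
  assumes "0 < r" "r \<le> \<delta>" and lam: "0 < lam" and c: "0 < c" and M: "0 \<le> M"
    and d1: "\<And>t. t \<in> {r..\<delta>} \<Longrightarrow> (\<phi> has_real_derivative \<phi>' t) (at t within {r..\<delta>})"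
    and d2: "\<And>t. t \<in> {r..\<delta>} \<Longrightarrow> (\<phi>' has_real_derivative \<phi>'' t) (at t within {r..\<delta>})"
    and lower: "\<And>t. t \<in> {r..\<delta>} \<Longrightarrow> c * t ^ k \<le> \<bar>\<phi>' t\<bar>"
    and upper: "\<And>t. t \<in> {r..\<delta>} \<Longrightarrow> \<bar>\<phi>'' t\<bar> * t \<le> M * t ^ k"
  shows "norm (integral {r..\<delta>} (\<lambda>t. cis (lam * \<phi> t) / complex_of_real t))
    \<le> (3 / c + M / c\<^sup>2) / (lam * r ^ Suc k)"
proof -
  define w where "w t = 1 / (lam * (\<phi>' t * t))" for t
  define w' where "w' t = - (\<phi>'' t * t + \<phi>' t) / (lam * (\<phi>' t * t)\<^sup>2)" for t
  \<comment> \<open>\<open>G\<close> is an antiderivative of \<open>g + q\<close>, so \<open>q\<close> is integrable as the difference of a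
    derivative and a continuous function.\<close>
  define G where "G t = w t *\<^sub>R (- \<i> * cis (lam * \<phi> t))" for t
  define g where "g t = cis (lam * \<phi> t) / complex_of_real t" for t
  define q where "q t = w' t *\<^sub>R (- \<i> * cis (lam * \<phi> t))" for t
  define D where "D = M / c\<^sup>2 + 1 / c"
  have pos: "0 < t" if "t \<in> {r..\<delta>}" for t using that assms by auto
  have nz: "\<phi>' t \<noteq> 0" if "t \<in> {r..\<delta>}" for t
  proof -
    have "0 < c * t ^ k" using pos[OF that] c by simp
    with lower[OF that] show ?thesis by auto
  qed
  have dw: "(w has_real_derivative w' t) (at t within {r..\<delta>})" if "t \<in> {r..\<delta>}" for t
    unfolding w_def[abs_def] w'_def using nz[OF that] pos[OF that] lam that
    by (auto intro!: derivative_eq_intros d2 simp: field_simps power2_eq_square)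
  have dcis: "((\<lambda>t. - \<i> * cis (lam * \<phi> t)) has_vector_derivative
      (lam * \<phi>' t) *\<^sub>R cis (lam * \<phi> t)) (at t within {r..\<delta>})" if "t \<in> {r..\<delta>}" for t
    unfolding has_vector_derivative_def
    using d1[OF that, unfolded has_field_derivative_def]
    by (auto intro!: derivative_eq_intros simp: fun_eq_iff complex_eq_iff)
  have dG: "(G has_vector_derivative (g t + q t)) (at t within {r..\<delta>})" if "t \<in> {r..\<delta>}" for t
  proof -
    have "(G has_vector_derivative (w t *\<^sub>R ((lam * \<phi>' t) *\<^sub>R cis (lam * \<phi> t)) + q t)) (at t within {r..\<delta>})"
      unfolding G_def[abs_def] q_def
      by (rule has_vector_derivative_scaleR[OF dw[OF that] dcis[OF that]])
    moreover have "w t *\<^sub>R ((lam * \<phi>' t) *\<^sub>R cis (lam * \<phi> t)) = g t"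
      using nz[OF that] pos[OF that] lam
      by (simp add: w_def g_def scaleR_conv_of_real)
    ultimately show ?thesis by simp
  qed
  have "continuous_on {r..\<delta>} \<phi>"
    by (rule DERIV_continuous_on[OF d1])
  then have "continuous_on {r..\<delta>} g"
    unfolding g_def using \<open>0 < r\<close> by (intro continuous_on_cis_div)
  then have int_g: "(g has_integral integral {r..\<delta>} g) {r..\<delta>}"
    by (intro integrable_integral integrable_continuous_real)
  have "((\<lambda>t. g t + q t) has_integral (G \<delta> - G r)) {r..\<delta>}"
    using dG \<open>r \<le> \<delta>\<close> by (intro fundamental_theorem_of_calculus)
  from has_integral_diff[OF this int_g]
  have int_q: "(q has_integral (G \<delta> - G r - integral {r..\<delta>} g)) {r..\<delta>}" by simp
  have w_le: "\<bar>w t\<bar> \<le> 1 / (c * lam * r ^ Suc k)" if "t \<in> {r..\<delta>}" for t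
  proof -
    have "c * r ^ k * r \<le> c * t ^ k * t"
      using that pos[OF that] \<open>0 < r\<close> c by (intro mult_mono power_mono) auto
    also have "\<dots> \<le> \<bar>\<phi>' t\<bar> * t"
      using lower[OF that] pos[OF that] by (intro mult_right_mono) auto
    finally have "lam * (c * r ^ k * r) \<le> lam * (\<bar>\<phi>' t\<bar> * t)"
      using lam by simp
    moreover have "0 < lam * (c * r ^ k * r)" using lam c \<open>0 < r\<close> by simp
    ultimately have "1 / (lam * (\<bar>\<phi>' t\<bar> * t)) \<le> 1 / (lam * (c * r ^ k * r))"
      by (intro divide_left_mono) auto
    then show ?thesis using lam pos[OF that] by (simp add: w_def abs_mult mult_ac)
  qed
  have w'_le: "\<bar>w' t\<bar> \<le> D / lam * (1 / t ^ (k + 2))" if "t \<in> {r..\<delta>}" for t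
  proof -
    note p = pos[OF that]
    have x: "0 < c * t ^ k" using p c by simp
    have "\<bar>\<phi>'' t * t + \<phi>' t\<bar> \<le> M * t ^ k + \<bar>\<phi>' t\<bar>"
      using upper[OF that] p by (intro order_trans[OF abs_triangle_ineq]) (simp add: abs_mult)
    then have "\<bar>w' t\<bar> \<le> (M * t ^ k + \<bar>\<phi>' t\<bar>) / (lam * (\<phi>' t * t)\<^sup>2)"
      using lam by (simp add: w'_def abs_mult divide_right_mono)
    also have "\<dots> = (M * t ^ k / \<bar>\<phi>' t\<bar>\<^sup>2 + 1 / \<bar>\<phi>' t\<bar>) / (lam * t\<^sup>2)"
      using nz[OF that] p lam by (simp add: field_simps power2_eq_square)
    also have "\<dots> \<le> (M * t ^ k / (c * t ^ k)\<^sup>2 + 1 / (c * t ^ k)) / (lam * t\<^sup>2)"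
      using lower[OF that] x M p lam c nz[OF that]
      by (intro divide_right_mono add_mono divide_left_mono power_mono mult_pos_pos zero_less_power) auto
    also have "\<dots> = D / lam * (1 / t ^ (k + 2))"
      using p c lam by (simp add: D_def field_simps power2_eq_square)
    finally show ?thesis .
  qed
  have D: "0 \<le> D" using c M by (simp add: D_def)
  have "((\<lambda>t. 1 / t ^ (k + 2)) has_integral
      (- 1 / (real (Suc k) * \<delta> ^ Suc k) - - 1 / (real (Suc k) * r ^ Suc k))) {r..\<delta>}"
  proof (rule fundamental_theorem_of_calculus)
    fix t assume t: "t \<in> {r..\<delta>}"
    have pow: "((\<lambda>t. t ^ Suc k) has_real_derivative real (Suc k) * t ^ k) (at t within {r..\<delta>})"
      using DERIV_pow[of "Suc k" t "{r..\<delta>}"] by simp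
    have "((\<lambda>t. - 1 / real (Suc k) * inverse (t ^ Suc k)) has_real_derivative
        - 1 / real (Suc k) * - (inverse (t ^ Suc k) * (real (Suc k) * t ^ k) * inverse (t ^ Suc k)))
        (at t within {r..\<delta>})"
      using pos[OF t] by (intro DERIV_cmult DERIV_inverse'[OF pow]) auto
    moreover have "- 1 / real (Suc k) * - (inverse (t ^ Suc k) * (real (Suc k) * t ^ k) * inverse (t ^ Suc k))
        = 1 / t ^ (k + 2)"
      using pos[OF t] by (simp add: field_simps del: of_nat_Suc)
    ultimately have "((\<lambda>t. - 1 / (real (Suc k) * t ^ Suc k)) has_real_derivative 1 / t ^ (k + 2)) (at t within {r..\<delta>})"
      by (simp add: field_simps)
    then show "((\<lambda>t. - 1 / (real (Suc k) * t ^ Suc k)) has_vector_derivative 1 / t ^ (k + 2)) (at t within {r..\<delta>})"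
      by (simp add: has_real_derivative_iff_has_vector_derivative)
  qed (use assms in auto)
  note int_pow = has_integral_mult_right[OF this, of "D / lam"]
  have "norm (integral {r..\<delta>} q) \<le> integral {r..\<delta>} (\<lambda>t. D / lam * (1 / t ^ (k + 2)))"
  proof (rule integral_norm_bound_integral)
    show "norm (q t) \<le> D / lam * (1 / t ^ (k + 2))" if "t \<in> {r..\<delta>}" for t
      using w'_le[OF that] by (simp add: q_def norm_mult)
  qed (use int_q int_pow in \<open>auto simp: integrable_on_def\<close>)
  also have "\<dots> \<le> D / lam * (1 / r ^ Suc k)"
  proof -
    have "- 1 / (real (Suc k) * \<delta> ^ Suc k) - - 1 / (real (Suc k) * r ^ Suc k) \<le> 1 / (real (Suc k) * r ^ Suc k)"
      using assms by simp
    also have "\<dots> \<le> 1 / (1 * r ^ Suc k)"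
      using assms by (intro divide_left_mono mult_right_mono) auto
    finally show ?thesis
      unfolding integral_unique[OF int_pow] using D lam by (intro mult_left_mono) auto
  qed
  finally have qle: "norm (G \<delta> - G r - integral {r..\<delta>} g) \<le> D / (lam * r ^ Suc k)"
    using integral_unique[OF int_q] by simp
  have Gle: "norm (G t) \<le> 1 / (c * lam * r ^ Suc k)" if "t \<in> {r..\<delta>}" for t
    using w_le[OF that] by (simp add: G_def norm_mult)
  have tri: "norm (x - y - z) \<le> norm x + norm y + norm z" for x y z :: complex
    using norm_triangle_ineq4[of "x - y" z] norm_triangle_ineq4[of x y] by linarith
  have "integral {r..\<delta>} g = G \<delta> - G r - (G \<delta> - G r - integral {r..\<delta>} g)" by simp
  also have "norm \<dots> \<le> 1 / (c * lam * r ^ Suc k) + 1 / (c * lam * r ^ Suc k) + D / (lam * r ^ Suc k)"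
    by (intro order_trans[OF tri] add_mono Gle qle) (use \<open>r \<le> \<delta>\<close> in auto)
  also have "\<dots> = (3 / c + M / c\<^sup>2) / (lam * r ^ Suc k)"
    using c lam \<open>0 < r\<close> by (simp add: D_def field_simps)
  finally show ?thesis by (simp add: g_def[abs_def])
qed

text \<open>
Subtracting from \<open>f j\<close>, for each \<open>j\<close>, the corresponding derivative of the leading monomial gives
a sequence that vanishes at the origin one order further.
\<close>

lemma monomial_leading_term:
  fixes f :: "nat \<Rightarrow> real \<Rightarrow> real"
  assumes deriv: "\<And>j t. t \<in> {-1..1} \<Longrightarrow> (f j has_real_derivative f (Suc j) t) (at t within {-1..1})"
    and zero: "\<And>j. 0 < j \<Longrightarrow> j \<le> k \<Longrightarrow> f j 0 = 0"
    and bound: "\<And>t. t \<in> {-1..1} \<Longrightarrow> \<bar>f (Suc (Suc k)) t\<bar> \<le> M"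
    and t: "t \<in> {-1..1}"
  shows "\<bar>f 1 t - f (Suc k) 0 / fact k * t ^ k\<bar> \<le> M * \<bar>t\<bar> ^ Suc k"
proof -
  define c where "c = f (Suc k) 0"
  define p where "p j t = (if j \<le> k then c * (t ^ (k - j) / fact (k - j)) else 0)" for j and t :: real
  define g where "g j t = f (Suc j) t - p j t" for j t
  have dp: "(p j has_real_derivative p (Suc j) t) (at t within {-1..1})" for j t
  proof (cases "j < k")
    case True
    then obtain i where i: "k - j = Suc i" "k - Suc j = i" by (metis Suc_diff_Suc)
    have "((\<lambda>t. c * (t ^ Suc i / fact (Suc i))) has_real_derivative c * (t ^ i / fact i)) (at t within {-1..1})"
      using DERIV_cmult[OF DERIV_cdivide[OF DERIV_pow[of "Suc i"]], of c "fact (Suc i)"]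
      by (simp add: field_simps del: of_nat_Suc)
    then show ?thesis using True i by (simp add: p_def[abs_def])
  next
    case False
    then show ?thesis by (cases "j = k") (simp_all add: p_def[abs_def])
  qed
  have "\<bar>g 0 t\<bar> \<le> M * \<bar>t\<bar> ^ (Suc k - 0)"
  proof (rule iterated_mean_value_bound)
    fix j t assume "j < Suc k" "t \<in> {-1..1::real}"
    then show "(g j has_real_derivative g (Suc j) t) (at t within {-1..1})"
      unfolding g_def[abs_def] by (intro DERIV_diff deriv dp)
  next
    fix j assume "j < Suc k"
    then show "g j 0 = 0"
      using zero[of "Suc j"] by (cases "j = k") (auto simp: g_def p_def c_def power_0_left)
  qed (use bound t in \<open>auto simp: g_def p_def\<close>)
  then show ?thesis by (simp add: g_def p_def c_def)
qed

text \<open>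
On the non-stationary range each of the halves \<open>t > 0\<close> and \<open>t < 0\<close> is small by itself; the
factor 2 counts them.
\<close>

lemma norm_integral_odd_kernel_nonstationary:
  fixes f :: "nat \<Rightarrow> real \<Rightarrow> real"
  assumes deriv: "\<And>j t. t \<in> {-1..1} \<Longrightarrow> (f j has_real_derivative f (Suc j) t) (at t within {-1..1})"
    and "0 < r" "r \<le> \<delta>" "\<delta> \<le> 1" "0 < lam" "0 < c" "0 \<le> M"
    and lower: "\<And>t. \<bar>t\<bar> \<le> \<delta> \<Longrightarrow> c * \<bar>t\<bar> ^ k \<le> \<bar>f 1 t\<bar>"
    and upper: "\<And>t. \<bar>t\<bar> \<le> \<delta> \<Longrightarrow> \<bar>f 2 t\<bar> * \<bar>t\<bar> \<le> M * \<bar>t\<bar> ^ k"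
  shows "norm (integral {r..\<delta>} (odd_kernel (f 0) lam)) \<le> 2 * ((3 / c + M / c\<^sup>2) / (lam * r ^ Suc k))"
proof -
  let ?I = "\<lambda>\<phi>. integral {r..\<delta>} (\<lambda>t. cis (lam * \<phi> t) / complex_of_real t)"
  have sub: "{r..\<delta>} \<subseteq> {-1..1}" "uminus ` {r..\<delta>} \<subseteq> {-1..1}" using assms by auto
  have d: "(f j has_real_derivative f (Suc j) t) (at t within {r..\<delta>})" if "t \<in> {r..\<delta>}" for j t
    using deriv[of t j] that sub by (meson DERIV_subset subsetD)
  have dm: "((\<lambda>t. f j (-t)) has_real_derivative - f (Suc j) (-t)) (at t within {r..\<delta>})" if "t \<in> {r..\<delta>}" for j t
  proof -
    have "-t \<in> {-1..1}" using that sub by auto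
    then have "(f j has_real_derivative f (Suc j) (-t)) (at (-t) within uminus ` {r..\<delta>})"
      using deriv[of "-t" j] sub by (meson DERIV_subset)
    from DERIV_image_chain[OF this DERIV_minus[OF DERIV_ident]] show ?thesis
      by (simp add: o_def)
  qed
  have "norm (?I (f 0)) \<le> (3 / c + M / c\<^sup>2) / (lam * r ^ Suc k)"
  proof (rule nonstationary_integral_bound[where \<phi>'="f 1" and \<phi>''="f 2"])
    fix t assume t: "t \<in> {r..\<delta>}"
    show "(f 0 has_real_derivative f 1 t) (at t within {r..\<delta>})" "(f 1 has_real_derivative f 2 t) (at t within {r..\<delta>})"
      using d[OF t, of 0] d[OF t, of 1] by (simp_all add: numeral_2_eq_2)
    show "c * t ^ k \<le> \<bar>f 1 t\<bar>" "\<bar>f 2 t\<bar> * t \<le> M * t ^ k"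
      using lower[of t] upper[of t] t \<open>0 < r\<close> by auto
  qed (use assms in auto)
  moreover
  have "norm (?I (\<lambda>t. f 0 (-t))) \<le> (3 / c + M / c\<^sup>2) / (lam * r ^ Suc k)"
  proof (rule nonstationary_integral_bound[where \<phi>'="\<lambda>t. - f 1 (-t)" and \<phi>''="\<lambda>t. f 2 (-t)"])
    fix t assume t: "t \<in> {r..\<delta>}"
    show "((\<lambda>t. f 0 (-t)) has_real_derivative - f 1 (-t)) (at t within {r..\<delta>})"
      "((\<lambda>t. - f 1 (-t)) has_real_derivative f 2 (-t)) (at t within {r..\<delta>})"
      using dm[OF t, of 0] DERIV_minus[OF dm[OF t, of 1]] by (simp_all add: numeral_2_eq_2)
    show "c * t ^ k \<le> \<bar>- f 1 (-t)\<bar>" "\<bar>f 2 (-t)\<bar> * t \<le> M * t ^ k"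
      using lower[of "-t"] upper[of "-t"] t \<open>0 < r\<close> by auto
  qed (use assms in auto)
  moreover have "integral {r..\<delta>} (odd_kernel (f 0) lam) = ?I (f 0) - ?I (\<lambda>t. f 0 (-t))"
  proof -
    note cont = C1_of_derivative_sequence(2)[of f 0, OF deriv]
    show ?thesis
      unfolding odd_kernel_def[abs_def] diff_divide_distrib
      by (rule integral_diff; rule integrable_continuous_real; rule continuous_on_cis_div)
        (use continuous_on_reflect[OF cont \<open>0 < r\<close> \<open>\<delta> \<le> 1\<close>] \<open>0 < r\<close> in auto)
  qed
  ultimately show ?thesis
    unfolding mult_2 by (simp only: order_trans[OF norm_triangle_ineq4 add_mono])
qed

text \<open>
If \<open>f (k + 1)\<close> is the first derivative that does not vanish at the origin, then
\<open>\<bar>f 1 t\<bar>\<close> is comparable to \<open>\<bar>t\<bar> ^ k\<close> near the origin. The natural scale is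
\<open>r = lam ^ (-1 / (k + 1))\<close>: below \<open>r\<close> the phase varies by \<open>O(1)\<close> and cancellation between \<open>t\<close>
and \<open>-t\<close> applies, between \<open>r\<close> and a fixed \<open>\<delta>\<close> the phase is non-stationary, and the range
beyond \<open>\<delta>\<close> contributes at most \<open>2 ln (1 / \<delta>)\<close>. No logarithm in \<open>lam\<close> appears.
\<close>

lemma stein_wainger_finite_type_bound:
  fixes f :: "nat \<Rightarrow> real \<Rightarrow> real"
  assumes deriv: "\<And>j t. t \<in> {-1..1} \<Longrightarrow> (f j has_real_derivative f (Suc j) t) (at t within {-1..1})"
    and zero: "\<And>j. 0 < j \<Longrightarrow> j \<le> k \<Longrightarrow> f j 0 = 0"
    and nz: "f (Suc k) 0 \<noteq> 0"
  shows "\<exists>C. \<forall>\<^sub>F lam in at_top. norm (stein_wainger (f 0) lam) \<le> C"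
proof -
  note C1 = C1_of_derivative_sequence[of f, OF deriv]
  have "\<exists>B>0. \<forall>t\<in>{-1..1}. \<bar>f j t\<bar> \<le> B" for j
  proof -
    have "bounded (f j ` {-1..1})"
      by (intro compact_imp_bounded compact_continuous_image C1(2)) auto
    then show ?thesis by (auto simp: bounded_pos)
  qed
  then obtain B1 B2 where B1: "0 < B1" "\<And>t. t \<in> {-1..1} \<Longrightarrow> \<bar>f (Suc k) t\<bar> \<le> B1"
    and B2: "0 < B2" "\<And>t. t \<in> {-1..1} \<Longrightarrow> \<bar>f (Suc (Suc k)) t\<bar> \<le> B2"
    by metis
  define M where "M = max B1 B2"
  have M: "0 < M" and M1: "\<And>t. t \<in> {-1..1} \<Longrightarrow> \<bar>f (Suc k) t\<bar> \<le> M"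
    and M2: "\<And>t. t \<in> {-1..1} \<Longrightarrow> \<bar>f (Suc (Suc k)) t\<bar> \<le> M"
    using B1 B2 by (fastforce simp: M_def)+
  define a where "a = \<bar>f (Suc k) 0\<bar> / fact k"
  have a: "0 < a" using nz by (simp add: a_def)
  define c where "c = a / 2"
  define \<delta> where "\<delta> = min 1 (a / (2 * M))"
  have \<delta>: "0 < \<delta>" "\<delta> \<le> 1" "M * \<delta> \<le> a / 2"
    using a M by (auto simp: \<delta>_def min_def field_simps)
  have lower: "c * \<bar>t\<bar> ^ k \<le> \<bar>f 1 t\<bar>" if t: "\<bar>t\<bar> \<le> \<delta>" for t
  proof -
    have "\<bar>f 1 t - f (Suc k) 0 / fact k * t ^ k\<bar> \<le> M * \<bar>t\<bar> ^ Suc k"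
      using t \<delta> by (intro monomial_leading_term deriv zero M2) auto
    also have "\<dots> \<le> M * \<delta> * \<bar>t\<bar> ^ k"
      using t M by (simp add: mult_right_mono mult_left_mono)
    also have "\<dots> \<le> a / 2 * \<bar>t\<bar> ^ k"
      using \<delta> by (intro mult_right_mono) auto
    finally have "\<bar>f 1 t - f (Suc k) 0 / fact k * t ^ k\<bar> \<le> a / 2 * \<bar>t\<bar> ^ k" .
    moreover have "\<bar>f (Suc k) 0 / fact k * t ^ k\<bar> = a * \<bar>t\<bar> ^ k"
      by (simp add: a_def abs_mult power_abs)
    moreover have "c * \<bar>t\<bar> ^ k = a * \<bar>t\<bar> ^ k - a / 2 * \<bar>t\<bar> ^ k"
      by (simp add: c_def field_simps)
    ultimately show ?thesis by linarith
  qed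
  have upper: "\<bar>f 2 t\<bar> * \<bar>t\<bar> \<le> M * \<bar>t\<bar> ^ k" if t: "\<bar>t\<bar> \<le> \<delta>" for t
  proof (cases k)
    case 0
    moreover have "t \<in> {-1..1}" using t \<delta> by auto
    ultimately show ?thesis using M2[of t] t \<delta> M
      using mult_mono[of "\<bar>f 2 t\<bar>" M "\<bar>t\<bar>" 1] by (simp add: numeral_2_eq_2)
  next
    case (Suc i)
    \<comment> \<open>The derivatives of \<open>f 1\<close> of orders below \<open>k\<close> vanish at the origin.\<close>
    define g where "g j = f (Suc j)" for j
    have "\<bar>g 1 t\<bar> \<le> M * \<bar>t\<bar> ^ (k - 1)"
      by (rule iterated_mean_value_bound)
        (use t \<delta> M1 zero Suc deriv in \<open>auto simp: g_def\<close>)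
    then have "\<bar>f 2 t\<bar> * \<bar>t\<bar> \<le> M * \<bar>t\<bar> ^ (k - 1) * \<bar>t\<bar>"
      by (intro mult_right_mono) (auto simp: g_def numeral_2_eq_2)
    then show ?thesis by (simp add: Suc mult_ac)
  qed
  define C where "C = 2 * M + 2 * (3 / c + M / c\<^sup>2) + 2 * ln (1 / \<delta>)"
  have "norm (stein_wainger (f 0) lam) \<le> C" if lam: "lam \<ge> 1 / \<delta> ^ Suc k" for lam
  proof -
    have lam0: "0 < lam" using lam \<delta> by (meson less_le_trans zero_less_divide_1_iff zero_less_power)
    define r where "r = root (Suc k) (1 / lam)"
    have r: "0 < r" and rk: "r ^ Suc k = 1 / lam"
      using lam0 by (auto simp: r_def simp del: power_Suc)
    have "r ^ Suc k \<le> \<delta> ^ Suc k"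
      using lam lam0 \<delta> by (simp only: rk) (simp add: field_simps)
    then have r\<delta>: "r \<le> \<delta>" using r \<delta> by (metis less_imp_le power_mono_iff zero_less_Suc)
    show ?thesis
    proof (rule norm_stein_wainger_le[OF C1(1) C1(2) r])
      fix \<epsilon> :: real assume eps: "0 < \<epsilon>" "\<epsilon> < r"
      have "norm (integral {\<epsilon>..r} (odd_kernel (f 0) lam)) \<le> lam * (2 * M) * r ^ Suc k"
      proof (rule norm_integral_odd_kernel_near)
        fix t :: real assume t: "0 < t" "t \<le> r"
        show "\<bar>f 0 t - f 0 (-t)\<bar> \<le> 2 * M * t ^ Suc k"
          using t r\<delta> \<delta> by (intro abs_diff_le_of_flat deriv zero M1) auto
      qed (use eps r\<delta> \<delta> M lam0 C1(2) in auto)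
      also have "\<dots> = 2 * M" using lam0 by (simp only: rk) simp
      finally have near: "norm (integral {\<epsilon>..r} (odd_kernel (f 0) lam)) \<le> 2 * M" .
      have mid: "norm (integral {r..\<delta>} (odd_kernel (f 0) lam)) \<le> 2 * (3 / c + M / c\<^sup>2)"
        using norm_integral_odd_kernel_nonstationary[of f r \<delta> lam c M k, OF deriv r r\<delta> \<delta>(2) lam0 _ _ lower upper]
          a M lam0 unfolding rk by (simp add: c_def)
      have far: "norm (integral {\<delta>..1} (odd_kernel (f 0) lam)) \<le> 2 * ln (1 / \<delta>)"
        using \<delta> lam0 C1(2) by (intro norm_integral_odd_kernel_far) auto
      have "truncated_stein_wainger (f 0) lam \<epsilon> = integral {\<epsilon>..r} (odd_kernel (f 0) lam) +
          (integral {r..\<delta>} (odd_kernel (f 0) lam) + integral {\<delta>..1} (odd_kernel (f 0) lam))"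
        using eps r\<delta> \<delta> r C1(2)
        by (subst truncated_stein_wainger_split[of _ _ r])
           (auto simp: Henstock_Kurzweil_Integration.integral_combine integrable_continuous_real continuous_on_odd_kernel)
      then show "norm (truncated_stein_wainger (f 0) lam \<epsilon>) \<le> C"
        unfolding C_def add.assoc[of "2 * M"]
        by (simp only: order_trans[OF norm_triangle_ineq add_mono[OF near
              order_trans[OF norm_triangle_ineq add_mono[OF mid far]]]])
    qed
  qed
  then show ?thesis
    by (auto simp: eventually_at_top_linorder)
qed

section \<open>The upper bound for Gevrey phases\<close>

lemma gevrey_derivative_sequence:
  assumes "\<psi> \<in> gevrey s {-1..1}"
  obtains K where "1 \<le> K"
    "\<And>j t. t \<in> {-1..1} \<Longrightarrow> (deriv_on {-1..1} j \<psi> has_real_derivative deriv_on {-1..1} (Suc j) \<psi> t) (at t within {-1..1})"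
    "\<And>n t. t \<in> {-1..1} \<Longrightarrow> \<bar>deriv_on {-1..1} n \<psi> t\<bar> \<le> K ^ (n + 1) * fact n powr s"
proof -
  from assms obtain K where K: "0 < K"
    "\<And>n t. t \<in> {-1..1} \<Longrightarrow> \<bar>deriv_on {-1..1} n \<psi> t\<bar> \<le> K ^ (n + 1) * fact n powr s"
    and smooth: "\<And>n. deriv_on {-1..1} n \<psi> differentiable_on {-1..1}"
    by (auto simp: gevrey_def C_infinity_on_def)
  show ?thesis
  proof (rule that[of "max 1 K"])
    fix j and t :: real assume t: "t \<in> {-1..1}"
    show "(deriv_on {-1..1} j \<psi> has_real_derivative deriv_on {-1..1} (Suc j) \<psi> t) (at t within {-1..1})"
      using smooth[of j] t
      by (simp add: has_real_derivative_iff_has_vector_derivative differentiable_on_def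
          vector_derivative_works[symmetric])
    show "\<bar>deriv_on {-1..1} j \<psi> t\<bar> \<le> max 1 K ^ (j + 1) * fact j powr s"
      using K(1) by (intro order_trans[OF K(2)[OF t]] mult_right_mono power_mono) auto
  qed auto
qed

lemma stein_wainger_gevrey_upper_bound:
  assumes "\<psi> \<in> gevrey s {-1..1}" "0 \<le> s"
  shows "\<exists>C. \<forall>\<^sub>F lam in at_top. norm (stein_wainger \<psi> lam) \<le> C * ln (ln lam)"
proof -
  obtain K where K: "1 \<le> K"
    "\<And>j t. t \<in> {-1..1} \<Longrightarrow> (deriv_on {-1..1} j \<psi> has_real_derivative deriv_on {-1..1} (Suc j) \<psi> t) (at t within {-1..1})"
    "\<And>n t. t \<in> {-1..1} \<Longrightarrow> \<bar>deriv_on {-1..1} n \<psi> t\<bar> \<le> K ^ (n + 1) * fact n powr s"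
    using gevrey_derivative_sequence[OF assms(1)] by metis
  define f where "f j = deriv_on {-1..1} j \<psi>" for j
  note df = K(2)[folded f_def]
  have f0: "f 0 = \<psi>" by (simp add: f_def)
  show ?thesis
  proof (cases "\<forall>j>0. f j 0 = 0")
    case True
    with stein_wainger_flat_bound[of f K s, OF df K(3)[folded f_def] K(1) assms(2)] show ?thesis
      by (simp add: f0)
  next
    case False
    define m where "m = (LEAST j. 0 < j \<and> f j 0 \<noteq> 0)"
    have m: "0 < m" "f m 0 \<noteq> 0"
      using False LeastI_ex[of "\<lambda>j. 0 < j \<and> f j 0 \<noteq> 0"] by (auto simp: m_def)
    have less: "f j 0 = 0" if "0 < j" "j < m" for j
      using that not_less_Least[of j "\<lambda>j. 0 < j \<and> f j 0 \<noteq> 0"] by (auto simp: m_def)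
    obtain k where k: "m = Suc k" using m by (cases m) auto
    obtain C where C: "\<forall>\<^sub>F lam in at_top. norm (stein_wainger \<psi> lam) \<le> C"
      using stein_wainger_finite_type_bound[of f k, OF df] less m k by (auto simp: f0)
    have "\<forall>\<^sub>F lam::real in at_top. 1 \<le> ln (ln lam)"
      by real_asymp
    with C have "\<forall>\<^sub>F lam in at_top. norm (stein_wainger \<psi> lam) \<le> \<bar>C\<bar> * ln (ln lam)"
    proof eventually_elim
      case (elim lam)
      have "norm (stein_wainger \<psi> lam) \<le> \<bar>C\<bar> * 1" using elim(1) by simp
      also have "\<dots> \<le> \<bar>C\<bar> * ln (ln lam)" using elim(2) by (intro mult_left_mono) auto
      finally show ?case .
    qed
    then show ?thesis by blast
  qed
qed

section \<open>A flat Gevrey phase\<close>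

lemma power_over_fact_le_exp:
  fixes x :: real
  assumes "0 \<le> x"
  shows "x ^ n \<le> fact n * exp x"
proof -
  have "(\<Sum>i\<in>{n}. inverse (fact i) *\<^sub>R x ^ i) \<le> exp x"
    unfolding exp_def using assms by (intro sum_le_suminf summable_exp_generic) auto
  then show ?thesis by (simp add: field_simps)
qed

definition flat_phase :: "nat \<Rightarrow> real \<Rightarrow> real" where
  "flat_phase p t = (if 0 < t then exp (- 1 / t ^ p) else 0)"

text \<open>
The holomorphic extension of \<^const>\<open>flat_phase\<close> from the positive axis to the punctured plane,
used to bound all its derivatives at once by Cauchy's inequality.
\<close>

definition flat_exp :: "nat \<Rightarrow> complex \<Rightarrow> complex" where
  "flat_exp p z = exp (- 1 / z ^ p)"

definition flat_phase_deriv :: "nat \<Rightarrow> nat \<Rightarrow> real \<Rightarrow> real" where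
  "flat_phase_deriv p n t = (if 0 < t then Re ((deriv ^^ n) (flat_exp p) (of_real t)) else 0)"

lemma flat_phase_deriv_0: "flat_phase_deriv p 0 = flat_phase p"
proof
  fix t
  have "exp (- 1 / complex_of_real t ^ p) = of_real (exp (- 1 / t ^ p))"
    by (simp flip: exp_of_real)
  then show "flat_phase_deriv p 0 t = flat_phase p t"
    by (simp add: flat_phase_deriv_def flat_phase_def flat_exp_def)
qed

lemma holomorphic_flat_exp: "flat_exp p holomorphic_on - {0}"
  unfolding flat_exp_def[abs_def] by (auto intro!: holomorphic_intros)

lemma Re_inverse_power_near_1:
  obtains \<kappa> where "0 < \<kappa>" "\<kappa> < 1" "\<And>w::complex. norm w \<le> \<kappa> \<Longrightarrow> 1 / 2 \<le> Re (1 / (1 + w) ^ p)"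
proof -
  have "((\<lambda>w::complex. Re (1 / (1 + w) ^ p)) \<longlongrightarrow> Re (1 / (1 + 0) ^ p)) (at 0)"
    by (intro tendsto_intros) auto
  then have "\<forall>\<^sub>F w in at 0. 1 / 2 < Re (1 / (1 + w :: complex) ^ p)"
    by (rule order_tendstoD) simp
  then obtain d where d: "0 < d" "\<And>w::complex. w \<noteq> 0 \<Longrightarrow> dist w 0 < d \<Longrightarrow> 1 / 2 < Re (1 / (1 + w) ^ p)"
    by (auto simp: eventually_at)
  show ?thesis
  proof (rule that[of "min (1/2) (d/2)"])
    fix w :: complex assume "norm w \<le> min (1/2) (d/2)"
    then show "1 / 2 \<le> Re (1 / (1 + w) ^ p)"
      using d(1) d(2)[of w] by (cases "w = 0") auto
  qed (use d in auto)
qed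

text \<open>
On the circle of radius \<open>\<kappa> t\<close> about \<open>t\<close> the points are \<open>t (1 + w)\<close> with \<open>\<bar>w\<bar> = \<kappa>\<close>, and
\<open>1 / (t (1 + w)) ^ p\<close> is \<open>1 / t ^ p\<close> times a number close to 1. So the function keeps half of
its exponential decay there, uniformly in \<open>t\<close> by homogeneity.
\<close>

lemma flat_exp_Cauchy_bound:
  obtains \<kappa> where "0 < \<kappa>" "\<kappa> < 1"
    "\<And>n t. 0 < t \<Longrightarrow> norm ((deriv ^^ n) (flat_exp p) (of_real t)) \<le> fact n * exp (- 1 / (2 * t ^ p)) / (\<kappa> * t) ^ n"
proof -
  obtain \<kappa> where \<kappa>: "0 < \<kappa>" "\<kappa> < 1" "\<And>w::complex. norm w \<le> \<kappa> \<Longrightarrow> 1 / 2 \<le> Re (1 / (1 + w) ^ p)"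
    using Re_inverse_power_near_1 by blast
  show ?thesis
  proof (rule that[OF \<kappa>(1,2)])
    fix n and t :: real assume t: "0 < t"
    have sub: "cball (complex_of_real t) (\<kappa> * t) \<subseteq> - {0}"
      using t \<kappa> by auto
    show "norm ((deriv ^^ n) (flat_exp p) (of_real t)) \<le> fact n * exp (- 1 / (2 * t ^ p)) / (\<kappa> * t) ^ n"
    proof (rule Cauchy_inequality)
      show "flat_exp p holomorphic_on ball (complex_of_real t) (\<kappa> * t)"
        by (rule holomorphic_on_subset[OF holomorphic_flat_exp]) (use sub ball_subset_cball in blast)
      show "continuous_on (cball (complex_of_real t) (\<kappa> * t)) (flat_exp p)"
        by (intro holomorphic_on_imp_continuous_on holomorphic_on_subset[OF holomorphic_flat_exp] sub)
      fix z assume z: "norm (complex_of_real t - z) = \<kappa> * t"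
      define w where "w = (z - of_real t) / of_real t"
      have "norm w = \<kappa>"
        using z t by (simp add: w_def norm_divide norm_minus_commute)
      then have half: "1 / 2 \<le> Re (1 / (1 + w) ^ p)"
        by (intro \<kappa>(3)) simp
      have "z = of_real t * (1 + w)"
        using t by (simp add: w_def field_simps)
      then have "1 / z ^ p = of_real (1 / t ^ p) * (1 / (1 + w) ^ p)"
        by (simp add: power_mult_distrib)
      then have "Re (1 / z ^ p) = 1 / t ^ p * Re (1 / (1 + w) ^ p)"
        by (simp only: Re_complex_of_real Im_complex_of_real times_complex.sel)
      also have "\<dots> \<ge> 1 / t ^ p * (1 / 2)"
        using t by (intro mult_left_mono half) auto
      finally show "norm (flat_exp p z) \<le> exp (- 1 / (2 * t ^ p))"
        by (simp add: flat_exp_def norm_exp_eq_Re mult.commute)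
    qed (use t \<kappa> in auto)
  qed
qed

text \<open>
Raise the left-hand side to the power \<open>p\<close> and put \<open>v = 1 / (2 t ^ p)\<close>: the result is
\<open>(2 v) ^ n exp (- p v)\<close>, which is at most \<open>2 ^ n n!\<close>. Taking the root turns \<open>n!\<close> into
\<open>(n!) powr (1 / p)\<close>, the excess of the Gevrey order over 1.
\<close>

lemma flat_exp_div_power_le:
  assumes p: "0 < p" "1 / real p \<le> \<sigma>" and t: "0 < t"
  shows "exp (- 1 / (2 * t ^ p)) / t ^ n \<le> 2 ^ n * fact n powr \<sigma>"
proof -
  define x where "x = exp (- 1 / (2 * t ^ p)) / t ^ n"
  define v where "v = 1 / (2 * t ^ p)"
  have x: "0 < x" and v: "0 < v" using t by (auto simp: x_def v_def)
  have "x ^ p = exp (- v) ^ p * (1 / (t ^ p) ^ n)"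
    by (simp add: x_def v_def power_divide power_mult[symmetric] mult.commute)
  also have "1 / (t ^ p) ^ n = 2 ^ n * v ^ n"
    using t by (simp add: v_def power_divide power_mult_distrib)
  also have "exp (- v) ^ p * (2 ^ n * v ^ n) \<le> exp (- v) ^ 1 * (2 ^ n * v ^ n)"
    using v p by (intro mult_right_mono power_decreasing) auto
  also have "\<dots> \<le> exp (- v) * (2 ^ n * (fact n * exp v))"
    using power_over_fact_le_exp[of v n] v by (simp add: mult_left_mono)
  also have "\<dots> = 2 ^ n * fact n"
    by (simp add: exp_minus)
  finally have xp: "x ^ p \<le> 2 ^ n * fact n" .
  have "x = (x ^ p) powr (1 / p)"
    using x p by (simp add: powr_realpow[symmetric] powr_powr)
  also have "\<dots> \<le> (2 ^ n * fact n) powr (1 / p)"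
    using xp x by (intro powr_mono2) auto
  also have "\<dots> = (2 ^ n) powr (1 / p) * fact n powr (1 / p)"
    by (simp add: powr_mult)
  also have "\<dots> \<le> (2 ^ n) powr 1 * fact n powr \<sigma>"
    using p by (intro mult_mono powr_mono) (auto simp: fact_ge_1)
  finally show ?thesis by (simp add: x_def)
qed

text \<open>
The case \<open>m = 0\<close> is the Gevrey estimate; the case \<open>m = 2\<close> says that every derivative vanishes
to second order at the origin, so that the next derivative exists there and is 0.
\<close>

lemma flat_phase_deriv_bound:
  assumes p: "0 < p" "1 / real p \<le> \<sigma>"
  obtains K where "1 \<le> K" "\<And>n m t. 0 < t \<Longrightarrow>
    \<bar>flat_phase_deriv p n t\<bar> \<le> K ^ n * fact n * (2 ^ m * fact (n + m) powr \<sigma>) * t ^ m"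
proof -
  obtain \<kappa> where \<kappa>: "0 < \<kappa>" "\<kappa> < 1"
    "\<And>n t. 0 < t \<Longrightarrow> norm ((deriv ^^ n) (flat_exp p) (of_real t)) \<le> fact n * exp (- 1 / (2 * t ^ p)) / (\<kappa> * t) ^ n"
    using flat_exp_Cauchy_bound by blast
  show ?thesis
  proof (rule that[of "2 / \<kappa>"])
    fix n m and t :: real assume t: "0 < t"
    have "\<bar>flat_phase_deriv p n t\<bar> \<le> fact n * exp (- 1 / (2 * t ^ p)) / (\<kappa> * t) ^ n"
      using \<kappa>(3)[OF t, of n] t abs_Re_le_cmod[of "(deriv ^^ n) (flat_exp p) (of_real t)"]
      by (simp add: flat_phase_deriv_def)
    also have "\<dots> = fact n / \<kappa> ^ n * (exp (- 1 / (2 * t ^ p)) / t ^ (n + m)) * t ^ m"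
      using t \<kappa> by (simp add: power_mult_distrib power_add)
    also have "\<dots> \<le> fact n / \<kappa> ^ n * (2 ^ (n + m) * fact (n + m) powr \<sigma>) * t ^ m"
      using t \<kappa> by (intro mult_right_mono mult_left_mono flat_exp_div_power_le p) auto
    also have "\<dots> = (2 / \<kappa>) ^ n * fact n * (2 ^ m * fact (n + m) powr \<sigma>) * t ^ m"
      by (simp add: power_divide power_add)
    finally show "\<bar>flat_phase_deriv p n t\<bar> \<le> (2 / \<kappa>) ^ n * fact n * (2 ^ m * fact (n + m) powr \<sigma>) * t ^ m" .
  qed (use \<kappa> in auto)
qed

lemma has_real_derivative_flat_phase_deriv:
  assumes p: "0 < p"
  shows "(flat_phase_deriv p n has_real_derivative flat_phase_deriv p (Suc n) t) (at t)"
proof -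
  consider "0 < t" | "t < 0" | "t = 0" by linarith
  then show ?thesis
  proof cases
    case 1
    have "((deriv ^^ n) (flat_exp p) has_field_derivative (deriv ^^ Suc n) (flat_exp p) (of_real t)) (at (of_real t))"
      using 1 by (intro has_field_derivative_higher_deriv[OF holomorphic_flat_exp]) auto
    from bounded_linear.has_vector_derivative[OF bounded_linear_Re has_vector_derivative_real_field[OF this]]
    have "((\<lambda>t. Re ((deriv ^^ n) (flat_exp p) (of_real t))) has_real_derivative flat_phase_deriv p (Suc n) t) (at t)"
      using 1 by (simp add: has_real_derivative_iff_has_vector_derivative flat_phase_deriv_def)
    then show ?thesis
      by (rule has_field_derivative_transform_within_open[of _ _ _ "{0<..}"])
         (use 1 in \<open>auto simp: flat_phase_deriv_def\<close>)
  next
    case 2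
    have "((\<lambda>t. 0) has_real_derivative flat_phase_deriv p (Suc n) t) (at t)"
      using 2 by (simp add: flat_phase_deriv_def)
    then show ?thesis
      by (rule has_field_derivative_transform_within_open[of _ _ _ "{..<0}"])
         (use 2 in \<open>auto simp: flat_phase_deriv_def\<close>)
  next
    case 3
    obtain K where K: "1 \<le> K" "\<And>n m t. 0 < t \<Longrightarrow>
        \<bar>flat_phase_deriv p n t\<bar> \<le> K ^ n * fact n * (2 ^ m * fact (n + m) powr (1 / p)) * t ^ m"
      using flat_phase_deriv_bound[OF p order_refl] by metis
    define C where "C = K ^ n * fact n * (2 ^ 2 * fact (n + 2) powr (1 / p))"
    have C: "0 \<le> C" using K(1) by (simp add: C_def)
    have le: "\<bar>flat_phase_deriv p n h\<bar> \<le> C * h\<^sup>2" for h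
      using K(2)[of h n 2] C by (cases "0 < h") (auto simp: C_def flat_phase_deriv_def)
    have "((\<lambda>h. flat_phase_deriv p n h / h) \<longlongrightarrow> 0) (at 0)"
    proof (rule Lim_null_comparison)
      have "norm (flat_phase_deriv p n h / h) \<le> C * \<bar>h\<bar>" if "h \<noteq> 0" for h
        using le[of h] that by (simp add: abs_divide divide_le_eq power2_eq_square mult.assoc)
      then show "\<forall>\<^sub>F h in at 0. norm (flat_phase_deriv p n h / h) \<le> C * \<bar>h\<bar>"
        by (simp add: eventually_at_filter)
      show "((\<lambda>h. C * \<bar>h\<bar>) \<longlongrightarrow> 0) (at 0)"
        by (auto intro!: tendsto_eq_intros)
    qed
    then show ?thesis using 3 by (simp add: DERIV_def flat_phase_deriv_def)
  qed
qed

lemma deriv_on_flat_phase: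
  assumes "0 < p" "t \<in> {-1..1}"
  shows "deriv_on {-1..1} n (flat_phase p) t = flat_phase_deriv p n t"
  using assms(2)
proof (induction n arbitrary: t)
  case 0
  then show ?case by (simp add: flat_phase_deriv_0)
next
  case (Suc n)
  have "(flat_phase_deriv p n has_vector_derivative flat_phase_deriv p (Suc n) t) (at t within {-1..1})"
    using has_real_derivative_flat_phase_deriv[OF assms(1), of n t]
    by (simp add: has_real_derivative_iff_has_vector_derivative has_vector_derivative_at_within)
  then have "(deriv_on {-1..1} n (flat_phase p) has_vector_derivative flat_phase_deriv p (Suc n) t) (at t within {-1..1})"
    by (rule has_vector_derivative_transform[OF Suc.prems, rotated]) (use Suc.IH in auto)
  then show ?case
    using vector_derivative_within_closed_interval[of "-1" 1 t] Suc.prems by simp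
qed

lemma flat_phase_gevrey:
  assumes p: "0 < p" "1 / real p \<le> s - 1"
  shows "flat_phase p \<in> gevrey s {-1..1}"
proof -
  have "deriv_on {-1..1} n (flat_phase p) differentiable_on {-1..1}" for n
    unfolding differentiable_on_def
  proof
    fix t :: real assume t: "t \<in> {-1..1}"
    have "(flat_phase_deriv p n has_vector_derivative flat_phase_deriv p (Suc n) t) (at t within {-1..1})"
      using has_real_derivative_flat_phase_deriv[OF p(1), of n t]
      by (simp add: has_real_derivative_iff_has_vector_derivative has_vector_derivative_at_within)
    then have "(deriv_on {-1..1} n (flat_phase p) has_vector_derivative flat_phase_deriv p (Suc n) t) (at t within {-1..1})"
      by (rule has_vector_derivative_transform[OF t, rotated]) (use deriv_on_flat_phase[OF p(1)] in auto)
    then show "deriv_on {-1..1} n (flat_phase p) differentiable at t within {-1..1}"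
      by (rule differentiableI_vector)
  qed
  moreover obtain K where K: "1 \<le> K" "\<And>n m t. 0 < t \<Longrightarrow>
        \<bar>flat_phase_deriv p n t\<bar> \<le> K ^ n * fact n * (2 ^ m * fact (n + m) powr (s - 1)) * t ^ m"
    using flat_phase_deriv_bound[OF p] by metis
  moreover have "\<bar>deriv_on {-1..1} n (flat_phase p) t\<bar> \<le> K ^ (n + 1) * fact n powr s"
    if t: "t \<in> {-1..1}" for n t
  proof (cases "0 < t")
    case True
    have "\<bar>flat_phase_deriv p n t\<bar> \<le> K ^ n * (fact n * fact n powr (s - 1))"
      using K(2)[OF True, of n 0] by (simp add: mult.assoc)
    also have "fact n * fact n powr (s - 1) = (fact n :: real) powr s"
      by (simp add: powr_diff)
    also have "K ^ n * fact n powr s \<le> K ^ (n + 1) * fact n powr s"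
      using K(1) by (intro mult_right_mono power_increasing) auto
    finally show ?thesis by (simp add: deriv_on_flat_phase[OF p(1) t])
  next
    case False
    then show ?thesis using K(1) by (simp add: deriv_on_flat_phase[OF p(1) t] flat_phase_deriv_def)
  qed
  ultimately show ?thesis
    unfolding gevrey_def C_infinity_on_def by (auto intro!: exI[of _ K])
qed

section \<open>Sharpness\<close>

text \<open>
After integration by parts against \<open>w = 1 / (lam * flat_phase' * t)\<close> the cosine contributes at
most \<open>2 w \<delta>\<close>, because \<open>w\<close> is positive and decreasing on \<open>(0, 1]\<close>. Hence the integral of
\<open>(1 - cos) / t\<close> differs little from that of \<open>1 / t\<close>.
\<close>

lemma flat_phase_oscillation_lower_bound:
  fixes \<delta> lam :: real
  assumes p: "0 < p" and lam: "0 < lam" and \<delta>: "0 < \<delta>" "\<delta> \<le> 1"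
    and int: "((\<lambda>t. (1 - cos (lam * flat_phase p t)) / t) has_integral I) {\<delta>..1}"
  shows "ln (1 / \<delta>) - 2 * (\<delta> ^ p * exp (1 / \<delta> ^ p) / (p * lam)) \<le> I"
proof -
  define w where "w t = t ^ p * exp (1 / t ^ p) / (p * lam)" for t
  define w' where "w' t = (t ^ p - 1) * exp (1 / t ^ p) / (t * lam)" for t
  define \<phi> where "\<phi> t = lam * exp (- 1 / t ^ p)" for t
  \<comment> \<open>With \<open>\<phi>' w = 1 / t\<close>, the derivative of \<open>sin \<phi> * w\<close> is \<open>cos \<phi> / t + sin \<phi> * w'\<close>. The extra
    summand \<open>w\<close> in \<open>H\<close> turns the error \<open>- sin \<phi> * w'\<close> into \<open>(1 - sin \<phi>) * w'\<close>, which is nonpositive.\<close>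
  define H where "H t = ln t - sin (\<phi> t) * w t + w t" for t
  define h where "h t = (1 - cos (\<phi> t)) / t + (1 - sin (\<phi> t)) * w' t" for t
  have phase: "lam * flat_phase p t = \<phi> t" if "t \<in> {\<delta>..1}" for t
    using that \<delta> by (simp add: \<phi>_def flat_phase_def)
  have dH: "(H has_real_derivative h t) (at t within {\<delta>..1})" if t: "t \<in> {\<delta>..1}" for t
  proof -
    have t0: "0 < t" using t \<delta> by simp
    obtain q where q: "p = Suc q" using p by (cases p) auto
    have pow: "((\<lambda>t. t ^ p) has_real_derivative real p * t ^ q) (at t within {\<delta>..1})"
      using DERIV_pow[of p t] by (simp add: q)
    have inv: "((\<lambda>t. 1 / t ^ p) has_real_derivative - (real p / (t ^ p * t))) (at t within {\<delta>..1})"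
    proof -
      have "- (inverse (t ^ p) * (real p * t ^ q) * inverse (t ^ p)) = - (real p / (t ^ p * t))"
        using t0 by (simp add: q field_simps)
      with DERIV_inverse'[OF pow] t0 show ?thesis by (simp add: inverse_eq_divide)
    qed
    have d\<phi>: "(\<phi> has_real_derivative real p / (t ^ p * t) * \<phi> t) (at t within {\<delta>..1})"
      using DERIV_cmult[OF DERIV_chain2[OF DERIV_exp DERIV_minus[OF inv]], of lam]
      by (simp add: \<phi>_def[abs_def] mult_ac)
    have "((\<lambda>t. t ^ p * exp (1 / t ^ p) / (p * lam)) has_real_derivative
        (real p * t ^ q * exp (1 / t ^ p) + exp (1 / t ^ p) * - (real p / (t ^ p * t)) * t ^ p) / (p * lam)) (at t within {\<delta>..1})"
      by (rule DERIV_cdivide[OF DERIV_mult[OF pow DERIV_chain2[OF DERIV_exp inv]]])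
    also have "(real p * t ^ q * exp (1 / t ^ p) + exp (1 / t ^ p) * - (real p / (t ^ p * t)) * t ^ p) / (p * lam) = w' t"
      using t0 lam p by (simp add: w'_def q field_simps del: of_nat_Suc)
    finally have dw: "(w has_real_derivative w' t) (at t within {\<delta>..1})"
      by (simp add: w_def[abs_def])
    have "real p / (t ^ p * t) * \<phi> t * w t = 1 / t"
      using t0 lam p by (simp add: \<phi>_def w_def exp_minus field_simps)
    then have "cos (\<phi> t) * (real p / (t ^ p * t) * \<phi> t) * w t = cos (\<phi> t) / t"
      by (metis mult.assoc mult.right_neutral times_divide_eq_right)
    then have h: "1 / t - (cos (\<phi> t) * (real p / (t ^ p * t) * \<phi> t) * w t + w' t * sin (\<phi> t)) + w' t = h t"
      by (simp only: h_def diff_divide_distrib) (simp add: algebra_simps)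
    have "(H has_real_derivative 1 / t - (cos (\<phi> t) * (real p / (t ^ p * t) * \<phi> t) * w t + w' t * sin (\<phi> t)) + w' t)
        (at t within {\<delta>..1})"
      unfolding H_def[abs_def] using t0
      by (auto intro!: derivative_eq_intros d\<phi> dw)
    then show ?thesis by (simp only: h)
  qed
  have "(h has_integral (H 1 - H \<delta>)) {\<delta>..1}"
    using \<delta> dH by (intro fundamental_theorem_of_calculus)
      (auto simp flip: has_real_derivative_iff_has_vector_derivative)
  then have "H 1 - H \<delta> \<le> I"
  proof (rule has_integral_le[OF _ int])
    fix t assume t: "t \<in> {\<delta>..1}"
    then have "w' t \<le> 0"
      using \<delta> lam by (auto simp: w'_def intro!: divide_nonpos_pos mult_nonpos_nonneg power_le_one)
    then have "(1 - sin (\<phi> t)) * w' t \<le> 0"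
      by (intro mult_nonneg_nonpos) auto
    then show "h t \<le> (1 - cos (lam * flat_phase p t)) / t"
      by (simp add: h_def phase[OF t])
  qed
  moreover have "0 \<le> H 1"
    using lam by (simp add: H_def w_def divide_right_mono)
  moreover have "H \<delta> \<le> ln \<delta> + 2 * w \<delta>"
  proof -
    have "0 \<le> w \<delta>" using \<delta> lam by (simp add: w_def)
    then have "- 1 * w \<delta> \<le> sin (\<phi> \<delta>) * w \<delta>"
      by (intro mult_right_mono) auto
    then show ?thesis by (simp add: H_def)
  qed
  ultimately show ?thesis
    using \<delta> by (simp add: w_def ln_div)
qed

text \<open>
Since the phase vanishes for negative \<open>t\<close>, minus the real part of the kernel is
\<open>(1 - cos (lam * flat_phase p t)) / t\<close>, which is nonnegative; so the range below \<open>\<delta>\<close> may be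
discarded. The choice \<open>\<delta> ^ p = 1 / ln lam\<close> is the point where \<open>lam * flat_phase p \<delta> = 1\<close>, that is,
where oscillation sets in.
\<close>

lemma stein_wainger_flat_phase_lower_bound:
  assumes p: "0 < p" and lam: "exp 1 \<le> lam"
  shows "ln (ln lam) / p - 2 \<le> norm (stein_wainger (flat_phase p) lam)"
proof -
  let ?\<psi> = "flat_phase p"
  define f where "f = flat_phase_deriv p"
  have f0: "f 0 = ?\<psi>" by (simp add: f_def flat_phase_deriv_0)
  have df: "(f j has_real_derivative f (Suc j) t) (at t within {-1..1})" for j t
    unfolding f_def by (rule has_field_derivative_at_within[OF has_real_derivative_flat_phase_deriv[OF p]])
  note C1 = C1_of_derivative_sequence[of f, OF df]
  have cont: "continuous_on {-1..1} ?\<psi>" using C1(2)[of 0] f0 by simp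
  have lam0: "0 < lam" using lam exp_gt_zero less_le_trans by blast
  have ln1: "1 \<le> ln lam" using lam lam0 by (simp add: ln_ge_iff)
  define \<delta> where "\<delta> = root p (1 / ln lam)"
  have \<delta>: "0 < \<delta>" "\<delta> \<le> 1"
    using p ln1 by (auto simp: \<delta>_def)
  have \<delta>p: "\<delta> ^ p = 1 / ln lam"
    unfolding \<delta>_def using p ln1 by (intro real_root_pow_pos) auto
  have ln\<delta>: "ln (1 / \<delta>) = ln (ln lam) / p"
    using p ln1 \<delta> by (simp add: \<delta>_def ln_div ln_root)
  define c where "c t = (1 - cos (lam * ?\<psi> t)) / t" for t
  have Re_int: "(c has_integral - Re (integral {a..b} (odd_kernel ?\<psi> lam))) {a..b}" if "0 < a" "b \<le> 1" for a b
  proof -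
    have "odd_kernel ?\<psi> lam integrable_on {a..b}"
      by (rule integrable_continuous_real[OF continuous_on_odd_kernel[OF cont that]])
    from has_integral_neg[OF has_integral_linear[OF integrable_integral[OF this] bounded_linear_Re]]
    show ?thesis
    proof (rule has_integral_eq[rotated])
      fix t assume "t \<in> {a..b}"
      then have "0 < t" using that by simp
      then show "- (Re \<circ> odd_kernel ?\<psi> lam) t = c t"
        by (simp add: odd_kernel_def c_def flat_phase_def Re_divide_of_real diff_divide_distrib)
    qed
  qed
  have "ln (ln lam) / p - 2 \<le> norm (truncated_stein_wainger ?\<psi> lam \<epsilon>)" if eps: "0 < \<epsilon>" "\<epsilon> < \<delta>" for \<epsilon>
  proof -
    have "0 \<le> - Re (integral {\<epsilon>..\<delta>} (odd_kernel ?\<psi> lam))"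
    proof (rule has_integral_nonneg[OF Re_int])
      fix t assume "t \<in> {\<epsilon>..\<delta>}"
      then show "0 \<le> c t" using eps by (simp add: c_def)
    qed (use eps \<delta> in auto)
    moreover have "ln (1 / \<delta>) - 2 * (\<delta> ^ p * exp (1 / \<delta> ^ p) / (p * lam)) \<le> - Re (integral {\<delta>..1} (odd_kernel ?\<psi> lam))"
      using \<delta> lam0 p Re_int[of \<delta> 1] by (intro flat_phase_oscillation_lower_bound) (auto simp: c_def[abs_def])
    moreover have "\<delta> ^ p * exp (1 / \<delta> ^ p) / (p * lam) \<le> 1"
    proof -
      have "\<delta> ^ p * exp (1 / \<delta> ^ p) / (p * lam) = 1 / (ln lam * p)"
        using lam0 by (simp add: \<delta>p)
      also have "\<dots> \<le> 1" using mult_ge1_I[of "ln lam" "real p"] ln1 p by simp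
      finally show ?thesis .
    qed
    moreover have "truncated_stein_wainger ?\<psi> lam \<epsilon> =
        integral {\<epsilon>..\<delta>} (odd_kernel ?\<psi> lam) + integral {\<delta>..1} (odd_kernel ?\<psi> lam)"
      using eps \<delta> by (intro truncated_stein_wainger_split cont) auto
    moreover have "- Re (truncated_stein_wainger ?\<psi> lam \<epsilon>) \<le> norm (truncated_stein_wainger ?\<psi> lam \<epsilon>)"
      using abs_Re_le_cmod[of "truncated_stein_wainger ?\<psi> lam \<epsilon>"] by linarith
    ultimately show ?thesis using ln\<delta> by simp
  qed
  then have "\<forall>\<^sub>F \<epsilon> in at_right 0. ln (ln lam) / p - 2 \<le> norm (truncated_stein_wainger ?\<psi> lam \<epsilon>)"
    using \<delta> by (auto simp: eventually_at_right_field)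
  moreover have "(truncated_stein_wainger ?\<psi> lam \<longlongrightarrow> stein_wainger ?\<psi> lam) (at_right 0)"
    using truncated_stein_wainger_tendsto[OF C1(1) C1(2)] by (simp add: f0)
  ultimately show ?thesis
    by (intro Lim_norm_lbound[of "at_right 0"]) auto
qed

theorem theorem1p3:
  fixes s :: real
  assumes "s > 1"
  shows "(\<forall>\<psi> \<in> gevrey s {-1..1}.
            stein_wainger \<psi> \<in> O[at_top](\<lambda>lam. complex_of_real (ln (ln lam)))) \<and>
         (\<exists>\<psi> \<in> gevrey s {-1..1}. \<exists>\<Lambda> :: nat \<Rightarrow> real.
            filterlim \<Lambda> at_top sequentially \<and>
            (\<exists>c>0. \<exists>C>0. \<forall>\<^sub>F n in sequentially.
               c * ln (ln (\<Lambda> n)) \<le> cmod (stein_wainger \<psi> (\<Lambda> n)) \<and>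
               cmod (stein_wainger \<psi> (\<Lambda> n)) \<le> C * ln (ln (\<Lambda> n))))"
proof
  have s: "0 \<le> s" using assms by simp
  show "\<forall>\<psi> \<in> gevrey s {-1..1}. stein_wainger \<psi> \<in> O[at_top](\<lambda>lam. complex_of_real (ln (ln lam)))"
  proof
    fix \<psi> assume "\<psi> \<in> gevrey s {-1..1}"
    then obtain C where "\<forall>\<^sub>F lam in at_top. norm (stein_wainger \<psi> lam) \<le> C * ln (ln lam)"
      using stein_wainger_gevrey_upper_bound s by blast
    moreover have "\<forall>\<^sub>F lam::real in at_top. 0 \<le> ln (ln lam)"
      by real_asymp
    ultimately have "\<forall>\<^sub>F lam in at_top. norm (stein_wainger \<psi> lam) \<le> C * norm (complex_of_real (ln (ln lam)))"
      by eventually_elim simp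
    then show "stein_wainger \<psi> \<in> O[at_top](\<lambda>lam. complex_of_real (ln (ln lam)))"
      by (rule bigoI)
  qed
  obtain m :: nat where m: "1 / (s - 1) \<le> m" using real_arch_simple by blast
  \<comment> \<open>A natural exponent \<open>p\<close> avoids complex powers; any \<open>p\<close> with \<open>1 + 1 / p \<le> s\<close> will do.\<close>
  define p where "p = Suc m"
  have "1 / (s - 1) \<le> real p" using m by (simp add: p_def)
  then have p: "0 < p" "1 / real p \<le> s - 1"
    using assms by (auto simp: p_def field_simps)
  let ?\<psi> = "flat_phase p"
  have gev: "?\<psi> \<in> gevrey s {-1..1}" by (rule flat_phase_gevrey[OF p])
  obtain C where C: "\<forall>\<^sub>F lam in at_top. norm (stein_wainger ?\<psi> lam) \<le> C * ln (ln lam)"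
    using stein_wainger_gevrey_upper_bound[OF gev s] by blast
  have "\<forall>\<^sub>F lam::real in at_top. 4 * p \<le> ln (ln lam)"
    by real_asymp
  with C eventually_ge_at_top[of "exp 1"]
  have "\<forall>\<^sub>F lam in at_top. 1 / (2 * p) * ln (ln lam) \<le> norm (stein_wainger ?\<psi> lam) \<and>
      norm (stein_wainger ?\<psi> lam) \<le> (\<bar>C\<bar> + 1) * ln (ln lam)"
  proof eventually_elim
    case (elim lam)
    have L: "0 \<le> ln (ln lam)" using elim(3) by linarith
    have "1 / (2 * p) * ln (ln lam) = ln (ln lam) / p - ln (ln lam) / (2 * p)"
      using p by (simp add: field_simps)
    also have "\<dots> \<le> ln (ln lam) / p - 2"
      using elim(3) p by (simp add: field_simps)
    also have "\<dots> \<le> norm (stein_wainger ?\<psi> lam)"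
      by (rule stein_wainger_flat_phase_lower_bound[OF p(1) elim(2)])
    finally have "1 / (2 * p) * ln (ln lam) \<le> norm (stein_wainger ?\<psi> lam)" .
    moreover have "C * ln (ln lam) \<le> (\<bar>C\<bar> + 1) * ln (ln lam)"
      using L by (intro mult_right_mono) auto
    ultimately show ?case using elim(1) by linarith
  qed
  then have "\<forall>\<^sub>F n in sequentially. 1 / (2 * p) * ln (ln (real n)) \<le> norm (stein_wainger ?\<psi> (real n)) \<and>
      norm (stein_wainger ?\<psi> (real n)) \<le> (\<bar>C\<bar> + 1) * ln (ln (real n))"
    using filterlim_real_sequentially by (rule eventually_compose_filterlim)
  moreover have "0 < 1 / real (2 * p)" "0 < \<bar>C\<bar> + 1" using p by auto
  ultimately have "\<exists>c>0. \<exists>C>0. \<forall>\<^sub>F n in sequentially. c * ln (ln (real n)) \<le> norm (stein_wainger ?\<psi> (real n)) \<and>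
      norm (stein_wainger ?\<psi> (real n)) \<le> C * ln (ln (real n))"
    by (intro exI[of _ "1 / real (2 * p)"] conjI exI[of _ "\<bar>C\<bar> + 1"])
  with gev filterlim_real_sequentially
  show "\<exists>\<psi> \<in> gevrey s {-1..1}. \<exists>\<Lambda> :: nat \<Rightarrow> real.
            filterlim \<Lambda> at_top sequentially \<and>
            (\<exists>c>0. \<exists>C>0. \<forall>\<^sub>F n in sequentially.
               c * ln (ln (\<Lambda> n)) \<le> cmod (stein_wainger \<psi> (\<Lambda> n)) \<and>
               cmod (stein_wainger \<psi> (\<Lambda> n)) \<le> C * ln (ln (\<Lambda> n)))"
    by (intro bexI[of _ ?\<psi>] exI[of _ real] conjI)
qed

end
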